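(* Let $m\ge1$ and let $V_m$ be a surface obtained by the construction described in the context (with exponents $k=3$, $l=2$), so that $V_m\setminus E_m\simeq\mathbb{C}^2_{u,v}\setminus\{(u,v)\mid u^3-v^2=0\}$. Then $V_m$ is holomorphically dominable by $\mathbb{C}^2$.
   Context: A complex surface $X$ is called holomorphically dominable by $\mathbb{C}^2$ if there is a holomorphic map $\mathbb{C}^2\to X$ whose Jacobian determinant is not identically zero. Construction of $V_m$. All varieties are over $\mathbb{C}$. Let $L_0\subset\mathbb{C}^2_{u,v}$ be the curve $u^3-v^2=0$. Let $V_1'\to\mathbb{C}^2_{u,v}$ be the blow-up at the point $(1,1)$, $E_1'$ its exceptional divisor, $\tilde L_0\subset V_1'$ the proper transform of $L_0$, and put $V_1=V_1'\setminus\tilde L_0$, $E_1=E_1'\setminus\tilde L_0$. For $i=2,\dots,m$ let $V_i'\to V_{i-1}$ be the blow-up at a (freely chosen) point of $E_{i-1}$, $E_i'$ its exceptional divisor, $\tilde E_{i-1}\subset V_i'$ the proper transform of $E_{i-1}$, and put $V_i=V_i'\setminus\tilde E_{i-1}$, $E_i=E_i'\setminus\tilde E_{i-1}$. Thus $V_m$ is a smooth surface which is the disjoint union of an open subset isomorphic to $\mathbb{C}^2\setminus L_0$ and the closed curve $E_m\simeq\mathbb{C}$. *)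

theory Defs
  imports "HOL-Analysis.Analysis"
begin

text \<open>
  A complex surface is given by a holomorphic atlas: a set of pairs \<open>(U, \<phi>)\<close>, where \<open>\<phi>\<close> maps \<open>U\<close>
  injectively onto an open subset of \<open>\<complex>\<^sup>2\<close> (values of \<open>\<phi>\<close> outside \<open>U\<close> are irrelevant). The atlas
  determines the set of points and the topology. Atlases are not required to be maximal; the
  notions below depend only on the induced complex structure.
\<close>

type_synonym 'a atlas = "('a set \<times> ('a \<Rightarrow> complex^2)) set"

text \<open>Holomorphy in two variables: total differentiability with a \<open>\<complex>\<close>-linear derivative.\<close>

definition holomorphic2_on :: "(complex^2 \<Rightarrow> complex^2) \<Rightarrow> (complex^2) set \<Rightarrow> bool"
    (infixl \<open>holomorphic2'_on\<close> 50) where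
  "f holomorphic2_on S \<longleftrightarrow>
     open S \<and> (\<forall>z\<in>S. \<exists>J :: complex^2^2. (f has_derivative (\<lambda>h. J *v h)) (at z))"

definition points :: "'a atlas \<Rightarrow> 'a set" where
  "points X = (\<Union>(U, \<phi>)\<in>X. U)"

text \<open>
  The topology for which all charts are homeomorphisms onto open subsets of \<open>\<complex>\<^sup>2\<close>;
  see \<open>openin_surface_topology\<close> below.
\<close>

definition surface_topology :: "'a atlas \<Rightarrow> 'a topology" where
  "surface_topology X =
     topology (\<lambda>S. S \<subseteq> points X \<and> (\<forall>(U, \<phi>)\<in>X. open (\<phi> ` (U \<inter> S))))"

definition complex_surface :: "'a atlas \<Rightarrow> bool" where
  "complex_surface X \<longleftrightarrow>
     (\<forall>(U, \<phi>)\<in>X. inj_on \<phi> U) \<and>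
     (\<forall>(U, \<phi>)\<in>X. \<forall>(W, \<psi>)\<in>X. (\<psi> \<circ> inv_into U \<phi>) holomorphic2_on (\<phi> ` (U \<inter> W))) \<and>
     Hausdorff_space (surface_topology X) \<and>
     second_countable (surface_topology X)"

definition holomorphic_map :: "'a atlas \<Rightarrow> 'b atlas \<Rightarrow> ('a \<Rightarrow> 'b) \<Rightarrow> bool" where
  "holomorphic_map X Y f \<longleftrightarrow>
     continuous_map (surface_topology X) (surface_topology Y) f \<and>
     (\<forall>(U, \<phi>)\<in>X. \<forall>(W, \<psi>)\<in>Y.
        (\<psi> \<circ> f \<circ> inv_into U \<phi>) holomorphic2_on (\<phi> ` (U \<inter> f -` W)))"

definition biholomorphic_map :: "'a atlas \<Rightarrow> 'b atlas \<Rightarrow> ('a \<Rightarrow> 'b) \<Rightarrow> bool" where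
  "biholomorphic_map X Y f \<longleftrightarrow>
     holomorphic_map X Y f \<and>
     (\<exists>g. holomorphic_map Y X g \<and> (\<forall>x\<in>points X. g (f x) = x) \<and> (\<forall>y\<in>points Y. f (g y) = y))"

text \<open>The open subsurface with point set \<open>points X \<inter> S\<close>; meaningful if that set is open.\<close>

definition restrict_surface :: "'a atlas \<Rightarrow> 'a set \<Rightarrow> 'a atlas" where
  "restrict_surface X S = (\<lambda>(U, \<phi>). (U \<inter> S, \<phi>)) ` X"

definition C2 :: "(complex^2) atlas" where
  "C2 = {(UNIV, id)}"

text \<open>
  The blow-up of \<open>\<complex>\<^sup>2\<close> at the origin is the incidence surface
  \<open>{(z, l) | l a line through 0, z \<in> l}\<close>, with blow-down map \<open>fst\<close>. Its two standard charts are
  the inverses of the parametrizations \<open>(a, t) \<mapsto> ((a, a t), [1 : t])\<close> and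
  \<open>(s, b) \<mapsto> ((s b, b), [s : 1])\<close>.
\<close>

definition cline :: "complex^2 \<Rightarrow> (complex^2) set" where
  "cline v = range (\<lambda>c. c *s v)"

definition blowup_par1 :: "complex^2 \<Rightarrow> (complex^2) \<times> (complex^2) set" where
  "blowup_par1 w = (vector [w $ 1, w $ 1 * w $ 2], cline (vector [1, w $ 2]))"

definition blowup_par2 :: "complex^2 \<Rightarrow> (complex^2) \<times> (complex^2) set" where
  "blowup_par2 w = (vector [w $ 1 * w $ 2, w $ 2], cline (vector [w $ 1, 1]))"

definition blowup_C2 :: "((complex^2) \<times> (complex^2) set) atlas" where
  "blowup_C2 = {(range blowup_par1, inv blowup_par1), (range blowup_par2, inv blowup_par2)}"

text \<open>
  \<open>is_blowup X' \<pi> X p\<close>: the map \<open>\<pi> : X' \<rightarrow> X\<close> is the blow-up of the surface \<open>X\<close> at the point \<open>p\<close>,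
  i.e. it is biholomorphic away from \<open>p\<close> and, in a coordinate \<open>\<phi>\<close> of some neighbourhood \<open>U\<close> of \<open>p\<close>
  centred at \<open>p\<close>, it is isomorphic to the blow-up of \<open>\<phi> ` U \<subseteq> \<complex>\<^sup>2\<close> at the origin.
\<close>

definition is_blowup :: "'a atlas \<Rightarrow> ('a \<Rightarrow> 'b) \<Rightarrow> 'b atlas \<Rightarrow> 'b \<Rightarrow> bool" where
  "is_blowup X' \<pi> X p \<longleftrightarrow>
     complex_surface X' \<and> complex_surface X \<and> p \<in> points X \<and>
     holomorphic_map X' X \<pi> \<and>
     biholomorphic_map (restrict_surface X' (- (\<pi> -` {p}))) (restrict_surface X (- {p})) \<pi> \<and>
     (\<exists>U \<phi> \<Phi>.
        openin (surface_topology X) U \<and> p \<in> U \<and> open (\<phi> ` U) \<and> \<phi> p = 0 \<and>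
        biholomorphic_map (restrict_surface X U) (restrict_surface C2 (\<phi> ` U)) \<phi> \<and>
        biholomorphic_map (restrict_surface X' (\<pi> -` U))
          (restrict_surface blowup_C2 (fst -` (\<phi> ` U))) \<Phi> \<and>
        (\<forall>y\<in>points X' \<inter> \<pi> -` U. fst (\<Phi> y) = \<phi> (\<pi> y)))"

definition exceptional_curve :: "'a atlas \<Rightarrow> ('a \<Rightarrow> 'b) \<Rightarrow> 'b \<Rightarrow> 'a set" where
  "exceptional_curve X' \<pi> p = points X' \<inter> \<pi> -` {p}"

definition proper_transform :: "'a atlas \<Rightarrow> ('a \<Rightarrow> 'b) \<Rightarrow> 'b \<Rightarrow> 'b set \<Rightarrow> 'a set" where
  "proper_transform X' \<pi> p C = surface_topology X' closure_of (points X' \<inter> \<pi> -` (C - {p}))"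

definition L0 :: "(complex^2) set" where
  "L0 = {z. (z $ 1) ^ 3 - (z $ 2) ^ 2 = 0}"

text \<open>
  \<open>V_construction m V E\<close>: the surface \<open>V\<close> is a possible outcome \<open>V\<^sub>m\<close> of the construction, for some
  choice of centres, and \<open>E\<close> is the curve \<open>E\<^sub>m \<subseteq> V\<^sub>m\<close>. Since blow-ups are only determined up to
  isomorphism, all the surfaces involved may be taken to have points in one type.
\<close>

inductive V_construction :: "nat \<Rightarrow> 'a atlas \<Rightarrow> 'a set \<Rightarrow> bool" where
  V_first:
    "is_blowup V' \<pi> C2 (vector [1, 1]) \<Longrightarrow>
     T = proper_transform V' \<pi> (vector [1, 1]) L0 \<Longrightarrow>
     V_construction 1 (restrict_surface V' (- T)) (exceptional_curve V' \<pi> (vector [1, 1]) - T)"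
| V_step:
    "V_construction i V E \<Longrightarrow> p \<in> E \<Longrightarrow>
     is_blowup V' \<pi> V p \<Longrightarrow>
     T = proper_transform V' \<pi> p E \<Longrightarrow>
     V_construction (Suc i) (restrict_surface V' (- T)) (exceptional_curve V' \<pi> p - T)"

text \<open>
  The Jacobian determinant of \<open>F : \<complex>\<^sup>2 \<rightarrow> X\<close> is computed in charts of \<open>X\<close>; whether it vanishes at a
  point does not depend on the chart.
\<close>

definition dominable_by_C2 :: "'a atlas \<Rightarrow> bool" where
  "dominable_by_C2 X \<longleftrightarrow>
     complex_surface X \<and>
     (\<exists>F. holomorphic_map C2 X F \<and>
        (\<exists>z. \<exists>(U, \<phi>)\<in>X. \<exists>J :: complex^2^2.
           F z \<in> U \<and> ((\<phi> \<circ> F) has_derivative (\<lambda>h. J *v h)) (at z) \<and> det J \<noteq> 0))"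

lemma openin_surface_topology:
  assumes "\<And>U \<phi>. (U, \<phi>) \<in> X \<Longrightarrow> inj_on \<phi> U"
  shows "openin (surface_topology X) S \<longleftrightarrow>
           S \<subseteq> points X \<and> (\<forall>(U, \<phi>)\<in>X. open (\<phi> ` (U \<inter> S)))"
proof -
  have "istopology (\<lambda>S. S \<subseteq> points X \<and> (\<forall>(U, \<phi>)\<in>X. open (\<phi> ` (U \<inter> S))))"
    unfolding istopology_def
  proof (intro conjI allI impI)
    fix S T
    assume S: "S \<subseteq> points X \<and> (\<forall>(U, \<phi>)\<in>X. open (\<phi> ` (U \<inter> S)))"
      and T: "T \<subseteq> points X \<and> (\<forall>(U, \<phi>)\<in>X. open (\<phi> ` (U \<inter> T)))"
    show "S \<inter> T \<subseteq> points X" using S by blast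
    show "\<forall>(U, \<phi>)\<in>X. open (\<phi> ` (U \<inter> (S \<inter> T)))"
    proof clarify
      fix U \<phi> assume U: "(U, \<phi>) \<in> X"
      have "\<phi> ` (U \<inter> (S \<inter> T)) = \<phi> ` (U \<inter> S) \<inter> \<phi> ` (U \<inter> T)"
        using assms[OF U] by (auto simp: inj_on_def)
      then show "open (\<phi> ` (U \<inter> (S \<inter> T)))" using S T U by auto
    qed
  next
    fix \<K>
    assume K: "\<forall>S\<in>\<K>. S \<subseteq> points X \<and> (\<forall>(U, \<phi>)\<in>X. open (\<phi> ` (U \<inter> S)))"
    show "\<Union>\<K> \<subseteq> points X" using K by blast
    show "\<forall>(U, \<phi>)\<in>X. open (\<phi> ` (U \<inter> \<Union>\<K>))"
    proof clarify
      fix U \<phi> assume U: "(U, \<phi>) \<in> X"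
      have "\<phi> ` (U \<inter> \<Union>\<K>) = (\<Union>S\<in>\<K>. \<phi> ` (U \<inter> S))" by blast
      then show "open (\<phi> ` (U \<inter> \<Union>\<K>))" using K U by (auto intro!: open_UN)
    qed
  qed
  then show ?thesis
    unfolding surface_topology_def by (simp add: topology_inverse')
qed

end

theory Submission
  imports Defs "HOL-Complex_Analysis.Cauchy_Integral_Formula"
begin

text \<open>
  Let \<open>a = x\<^sup>2 + 4 x + 1\<close> and \<open>b = 1 - 15/2 x - 6 x\<^sup>2 - x\<^sup>3\<close>, so that
  \<open>a\<^sup>3 - b\<^sup>2 = 27/4 x (x + 4)\<close>. On the domain \<open>x \<noteq> -4\<close>, the map
  \<open>F\<^sub>0 (x, s) = (a exp (2 s), b exp (3 s))\<close> meets the cusp curve exactly along \<open>x = 0\<close>, passes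
  through \<open>(1, 1)\<close> at \<open>(0, 0)\<close> and is a local isomorphism there. If \<open>F\<close> maps the same domain to a
  surface, meets a curve \<open>E\<close> exactly along \<open>x = 0\<close> and is a local isomorphism at \<open>(0, s0)\<close>, then
  \<open>(x, s) \<mapsto> F (x, s0 + x s)\<close> lifts to the blow-up at \<open>p = F (0, s0)\<close>; the lift avoids the proper
  transform of \<open>E\<close>, meets the exceptional curve exactly along \<open>x = 0\<close>, covers all of it but the
  tangent direction of \<open>E\<close>, and is a local isomorphism along \<open>x = 0\<close>. Hence the construction can be
  followed step by step, and substituting \<open>x = 4 (exp y - 1)\<close> in the final map makes it entire.
\<close>

text \<open>The centres are arbitrary, so after each step every point of the new curve must be
  reached. What makes the step repeatable is that two omissions match. The curves
  \<open>s = const\<close> of the reparametrized map leave \<open>p\<close> in the directions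
  \<open>dF (1, s)\<close>, where \<open>dF\<close> is the derivative at \<open>(0, s0)\<close>;
  these are all directions except \<open>dF (0, 1)\<close>. Since \<open>F (0, s)\<close> runs
  inside \<open>E\<close>, the missing direction is the tangent of \<open>E\<close>, and its point
  is exactly the one that the construction deletes together with the proper transform. So the line
  \<open>x = 0\<close> covers the whole new curve, and any next centre has a preimage
  \<open>(0, s0)\<close>. Elsewhere the map need only be holomorphic and stay off the curve, because
  blowing up changes nothing there. Every step keeps the coordinate \<open>x\<close>, so the second
  zero \<open>x = -4\<close> of \<open>a^3 - b^2\<close> remains the only value to be avoided,
  however many steps are made. The analytic obstacle is that the lift divides by a function
  vanishing on \<open>x = 0\<close>, while holomorphy means total differentiability; a removable
  singularity theorem in two variables has to be proved.\<close>

section \<open>Calculus in two complex variables\<close>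

text \<open>The derivative is total and complex linear; only its row \<open>(p, q)\<close> is named,
  so that matrices can be assembled row by row and one-variable rules applied to each entry.\<close>

definition has_partials :: "(complex^2 \<Rightarrow> complex) \<Rightarrow> complex^2 \<Rightarrow> complex \<Rightarrow> complex \<Rightarrow> bool" where
  "has_partials f z p q \<longleftrightarrow> (f has_derivative (\<lambda>h. p * h $ 1 + q * h $ 2)) (at z)"

lemma vector2_eta [simp]: "vector [z $ 1, z $ 2] = (z :: 'a::zero^2)"
  by (simp add: vec_eq_iff forall_2)

lemma vector2_zero: "vector [0, 0] = (0 :: complex^2)"
  by (simp add: vec_eq_iff forall_2)

lemma mat2_vec_nth:
  fixes J :: "complex^2^2"
  shows "(J *v h) $ i = J $ i $ 1 * h $ 1 + J $ i $ 2 * h $ 2"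
  by (simp add: matrix_vector_mult_def UNIV_2)

text \<open>The two coordinate embeddings: a pair of functions is written as a sum of their images,
  so sum rules give its derivative and continuity.\<close>

lemma bounded_linear_vector2:
  "bounded_linear (\<lambda>c::complex. vector [c, 0] :: complex^2)"
  "bounded_linear (\<lambda>c::complex. vector [0, c] :: complex^2)"
  unfolding linear_conv_bounded_linear[symmetric]
  by (rule linearI; simp add: vec_eq_iff forall_2)+

lemma has_derivative_vec2_iff:
  fixes f :: "complex^2 \<Rightarrow> complex^2"
  shows "(f has_derivative (\<lambda>h. J *v h)) (at z) \<longleftrightarrow>
     has_partials (\<lambda>z. f z $ 1) z (J $ 1 $ 1) (J $ 1 $ 2) \<and>
     has_partials (\<lambda>z. f z $ 2) z (J $ 2 $ 1) (J $ 2 $ 2)" (is "?L \<longleftrightarrow> ?R")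
proof
  assume L: ?L
  show ?R
    using bounded_linear.has_derivative[OF bounded_linear_vec_nth L, of 1]
      bounded_linear.has_derivative[OF bounded_linear_vec_nth L, of 2]
    by (simp add: has_partials_def mat2_vec_nth)
next
  assume ?R
  then have "((\<lambda>z. vector [f z $ 1, 0] + vector [0, f z $ 2] :: complex^2) has_derivative
      (\<lambda>h. vector [J $ 1 $ 1 * h $ 1 + J $ 1 $ 2 * h $ 2, 0] +
           vector [0, J $ 2 $ 1 * h $ 1 + J $ 2 $ 2 * h $ 2] :: complex^2)) (at z)"
    unfolding has_partials_def
    by (auto intro!: has_derivative_add bounded_linear.has_derivative[OF bounded_linear_vector2(1)]
        bounded_linear.has_derivative[OF bounded_linear_vector2(2)])
  moreover have "(\<lambda>z. vector [f z $ 1, 0] + vector [0, f z $ 2] :: complex^2) = f"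
    "(\<lambda>h. vector [J $ 1 $ 1 * h $ 1 + J $ 1 $ 2 * h $ 2, 0] +
           vector [0, J $ 2 $ 1 * h $ 1 + J $ 2 $ 2 * h $ 2] :: complex^2) = (\<lambda>h. J *v h)"
    by (simp_all add: fun_eq_iff vec_eq_iff forall_2 mat2_vec_nth)
  ultimately show ?L by simp
qed

lemma has_partials_const: "has_partials (\<lambda>_. c) z 0 0"
  by (simp add: has_partials_def)

lemma has_partials_nth:
  "has_partials (\<lambda>z. z $ 1) z 1 0" "has_partials (\<lambda>z. z $ 2) z 0 1"
  by (simp_all add: has_partials_def bounded_linear_vec_nth bounded_linear_imp_has_derivative)

lemma has_partials_add:
  "has_partials f z p q \<Longrightarrow> has_partials g z p' q' \<Longrightarrow>
   has_partials (\<lambda>z. f z + g z) z (p + p') (q + q')"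
  unfolding has_partials_def by (drule (1) has_derivative_add) (simp add: algebra_simps)

lemma has_partials_mult:
  "has_partials f z p q \<Longrightarrow> has_partials g z p' q' \<Longrightarrow>
   has_partials (\<lambda>z. f z * g z) z (f z * p' + p * g z) (f z * q' + q * g z)"
  unfolding has_partials_def by (drule (1) has_derivative_mult) (simp add: algebra_simps)

lemma has_partials_compose:
  assumes "(g has_field_derivative d) (at (f z))" "has_partials f z p q"
  shows "has_partials (\<lambda>z. g (f z)) z (d * p) (d * q)"
  using has_derivative_compose[OF assms(2)[unfolded has_partials_def]
      assms(1)[unfolded has_field_derivative_def]]
  by (simp add: has_partials_def algebra_simps)

lemma has_partials_divide:
  assumes "has_partials f z p q" "has_partials g z p' q'" "g z \<noteq> 0"
  shows "has_partials (\<lambda>z. f z / g z) z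
    ((p * g z - f z * p') / (g z)^2) ((q * g z - f z * q') / (g z)^2)"
proof -
  have "has_partials (\<lambda>z. f z * inverse (g z)) z
     (f z * (- ((inverse (g z))^2) * p') + p * inverse (g z))
     (f z * (- ((inverse (g z))^2) * q') + q * inverse (g z))"
    by (intro has_partials_mult assms has_partials_compose[OF _ assms(2)])
      (use DERIV_inverse[OF assms(3)] in \<open>simp add: numeral_2_eq_2\<close>)
  then show ?thesis
    using assms(3) by (simp add: divide_inverse[symmetric] field_simps power2_eq_square)
qed

lemma has_partials_cong:
  assumes "has_partials f z p q" "open N" "z \<in> N" "\<And>w. w \<in> N \<Longrightarrow> g w = f w"
  shows "has_partials g z p q"
  unfolding has_partials_def
  by (rule has_derivative_transform_within_open[OF assms(1)[unfolded has_partials_def] assms(2,3)])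
    (simp add: assms(4))

text \<open>Restriction to coordinate lines gives access to one-variable theory: removable
  singularities and uniqueness of derivatives.\<close>

lemma has_partials_imp_slices:
  assumes "has_partials f z p q"
  shows "((\<lambda>x. f (vector [x, z $ 2])) has_field_derivative p) (at (z $ 1))"
    and "((\<lambda>y. f (vector [z $ 1, y])) has_field_derivative q) (at (z $ 2))"
proof -
  have f: "(f has_derivative (\<lambda>h. p * h $ 1 + q * h $ 2)) (at (vector [z $ 1, z $ 2]))"
    using assms by (simp add: has_partials_def)
  have "((\<lambda>x. vector [x, 0] + vector [0, z $ 2] :: complex^2) has_derivative
      (\<lambda>h. vector [h, 0])) (at (z $ 1))"
    by (rule has_derivative_add[where g' = "\<lambda>_. 0", simplified])
      (auto intro: bounded_linear_imp_has_derivative bounded_linear_vector2)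
  moreover have "(\<lambda>x. vector [x, 0] + vector [0, z $ 2] :: complex^2) = (\<lambda>x. vector [x, z $ 2])"
    by (simp add: fun_eq_iff vec_eq_iff forall_2)
  ultimately have "((\<lambda>x. vector [x, z $ 2] :: complex^2) has_derivative (\<lambda>h. vector [h, 0])) (at (z $ 1))"
    by simp
  from has_derivative_compose[OF this f]
  show "((\<lambda>x. f (vector [x, z $ 2])) has_field_derivative p) (at (z $ 1))"
    by (simp add: has_field_derivative_def)
  have "((\<lambda>x. vector [z $ 1, 0] + vector [0, x] :: complex^2) has_derivative
      (\<lambda>h. vector [0, h])) (at (z $ 2))"
    by (rule has_derivative_add[where f' = "\<lambda>_. 0", simplified])
      (auto intro: bounded_linear_imp_has_derivative bounded_linear_vector2)
  moreover have "(\<lambda>x. vector [z $ 1, 0] + vector [0, x] :: complex^2) = (\<lambda>x. vector [z $ 1, x])"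
    by (simp add: fun_eq_iff vec_eq_iff forall_2)
  ultimately have "((\<lambda>x. vector [z $ 1, x] :: complex^2) has_derivative (\<lambda>h. vector [0, h])) (at (z $ 2))"
    by simp
  from has_derivative_compose[OF this f]
  show "((\<lambda>y. f (vector [z $ 1, y])) has_field_derivative q) (at (z $ 2))"
    by (simp add: has_field_derivative_def)
qed

lemma continuous_on_vector2:
  assumes "continuous_on S f" "continuous_on S g"
  shows "continuous_on S (\<lambda>x. vector [f x, g x] :: complex^2)"
proof -
  have "continuous_on S (\<lambda>x. vector [f x, 0] + vector [0, g x] :: complex^2)"
    by (intro continuous_on_add bounded_linear.continuous_on[OF bounded_linear_vector2(1) assms(1)]
        bounded_linear.continuous_on[OF bounded_linear_vector2(2) assms(2)])
  moreover have "(\<lambda>x. vector [f x, 0] + vector [0, g x] :: complex^2) = (\<lambda>x. vector [f x, g x])"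
    by (simp add: fun_eq_iff vec_eq_iff forall_2)
  ultimately show ?thesis by (simp only:)
qed

text \<open>Pulled back to the interval from 0 to 1, the integrand is jointly continuous on a
  product with a compact factor. The parameter space is arbitrary because it is later a set of
  pairs.\<close>

lemma continuous_on_contour_integral_circlepath:
  fixes G :: "'a::topological_space \<Rightarrow> complex \<Rightarrow> complex"
  assumes "continuous_on (U \<times> sphere c r) (\<lambda>(x, u). G x u)" "r \<ge> 0"
  shows "continuous_on U (\<lambda>x. contour_integral (circlepath c r) (G x))"
proof -
  have "continuous_on (U \<times> {0..1}) (\<lambda>(x, t). G x (circlepath c r t))"
  proof -
    have "continuous_on (U \<times> {0..1}) ((\<lambda>(x, u). G x u) \<circ> (\<lambda>(x, t). (x, circlepath c r t)))"
    proof (rule continuous_on_compose)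
      show "continuous_on (U \<times> {0..1}) (\<lambda>(x, t). (x, circlepath c r t))"
        by (auto simp: split_beta circlepath intro!: continuous_intros)
      show "continuous_on ((\<lambda>(x, t). (x, circlepath c r t)) ` (U \<times> {0..1})) (\<lambda>(x, u). G x u)"
        using path_image_circlepath[of c r] assms(2)
        by (intro continuous_on_subset[OF assms(1)]) (auto simp: path_image_def)
    qed
    then show ?thesis by (simp add: o_def split_beta)
  qed
  then have "continuous_on (U \<times> cbox 0 1) (\<lambda>(x, t). G x (circlepath c r t) *
      vector_derivative (circlepath c r) (at t))"
    by (auto simp: split_beta vector_derivative_circlepath intro!: continuous_intros)
  from integral_continuous_on_param[OF this]
  show ?thesis by (simp add: contour_integral_integral)
qed

text \<open>
  A combination of Osgood's lemma with the removable singularity theorem: Cauchy's formula on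
  circles that avoid the line \<open>z $ 1 = 0\<close> shows that the first partial derivative is continuous.
\<close>

lemma has_partials_removable:
  fixes k :: "complex^2 \<Rightarrow> complex"
  assumes S: "open S" "z \<in> S" "z $ 1 = 0"
    and k1: "\<And>w. w \<in> S \<Longrightarrow> (\<lambda>x. k (vector [x, w $ 2])) field_differentiable at (w $ 1)"
    and k2: "(\<lambda>y. k (vector [0, y])) field_differentiable at (z $ 2)"
    and cont: "continuous_on (S \<inter> {w. w $ 1 \<noteq> 0}) k"
  shows "\<exists>p q. has_partials k z p q"
proof -
  \<comment> \<open>The variables are exchanged to fit \<open>has_derivative_partialsI\<close>: it
    asks for the first partial derivative at one point only, but for the second on a whole product,
    continuous at that point. The direction across the line, where Cauchy's formula applies, must
    therefore come second.\<close>
  define f where "f = (\<lambda>s x. k (vector [x, s]))"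
  define S' where "S' = (\<lambda>w. vector [snd w, fst w] :: complex^2) -` S"
  have "open S'"
    unfolding S'_def by (intro open_vimage S continuous_on_vector2 continuous_intros)
  moreover have "(z $ 2, 0) \<in> S'"
    using S(2) vector2_eta[of z] unfolding S'_def S(3) by simp
  ultimately obtain A B where AB: "open A" "open B" "z $ 2 \<in> A" "0 \<in> B" "A \<times> B \<subseteq> S'"
    by (rule open_prod_elim) auto
  obtain r where r: "r > 0" "cball 0 r \<subseteq> B" using AB open_contains_cball by metis
  define Y where "Y = ball (0::complex) r"
  have inS: "vector [x, s] \<in> S" if "s \<in> A" "x \<in> cball 0 r" for s x
    using AB(5) r(2) that unfolding S'_def by force
  have df: "f s field_differentiable at x" if "s \<in> A" "x \<in> cball 0 r" for s x
    using k1[OF inS[OF that]] by (simp add: f_def)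
  define d where "d = (\<lambda>(s, x). 1 / (2 * of_real pi * \<i>) *
    contour_integral (circlepath 0 r) (\<lambda>u. f s u / (u - x)^2))"
  have fd: "(f s has_field_derivative d (s, x)) (at x)" if "s \<in> A" "x \<in> Y" for s x
    unfolding d_def prod.case
  proof (rule Cauchy_derivative_integral_circlepath)
    show "continuous_on (cball 0 r) (f s)"
      by (intro continuous_at_imp_continuous_on ballI field_differentiable_imp_continuous_at df that)
    show "f s holomorphic_on ball 0 r"
      by (rule holomorphic_onI, rule field_differentiable_at_within, rule df[OF that(1)]) auto
  qed (use that in \<open>simp add: Y_def\<close>)
  have "continuous_on (A \<times> Y) (\<lambda>y. contour_integral (circlepath 0 r) ((\<lambda>(s, x) u. f s u / (u - x)^2) y))"
  proof (rule continuous_on_contour_integral_circlepath)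
    have "continuous_on ((A \<times> Y) \<times> sphere 0 r) (\<lambda>w. k (vector [snd w, fst (fst w)]))"
      by (rule continuous_on_compose2[OF cont])
        (use inS r(1) in \<open>auto intro!: continuous_on_vector2 continuous_intros\<close>)
    then show "continuous_on ((A \<times> Y) \<times> sphere 0 r)
        (\<lambda>(y, u). (\<lambda>(s, x) u. f s u / (u - x)^2) y u)"
      by (auto simp: split_beta f_def Y_def intro!: continuous_intros)
  qed (use r in auto)
  then have d: "continuous_on (A \<times> Y) d"
    unfolding d_def split_beta by (intro continuous_intros)
  have op: "open (A \<times> Y)" "(z $ 2, 0) \<in> A \<times> Y"
    using AB r by (auto simp: Y_def intro!: open_Times)
  obtain e where e: "((\<lambda>s. f s 0) has_field_derivative e) (at (z $ 2))"
    using k2 unfolding f_def field_differentiable_def by blast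
  have "((\<lambda>(s, x). f s x) has_derivative (\<lambda>(ts, tx). e * ts +
      blinfun_apply (blinfun_mult_right (d (z $ 2, 0))) tx)) (at (z $ 2, 0) within A \<times> Y)"
  proof (rule has_derivative_partialsI)
    show "((\<lambda>s. f s 0) has_derivative (\<lambda>ts. e * ts)) (at (z $ 2) within A)"
      using e by (simp add: has_field_derivative_def has_derivative_at_withinI)
    show "(f s has_derivative blinfun_apply (blinfun_mult_right (d (s, x)))) (at x within Y)"
      if "s \<in> A" "x \<in> Y" for s x
      using fd[OF that]
      by (simp add: has_field_derivative_def has_derivative_at_withinI blinfun_mult_right.rep_eq)
    have "continuous_on (A \<times> Y) (\<lambda>y. blinfun_mult_right (d y))"
      by (rule bounded_linear.continuous_on[OF bounded_linear_blinfun_mult_right d])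
    then show "continuous (at (z $ 2, 0) within A \<times> Y) (\<lambda>(s, x). blinfun_mult_right (d (s, x)))"
      using op(2) by (auto simp: continuous_on_eq_continuous_within case_prod_beta')
  qed (use r in \<open>auto simp: Y_def\<close>)
  then have "((\<lambda>(s, x). f s x) has_derivative (\<lambda>(ts, tx). e * ts + d (z $ 2, 0) * tx))
      (at ((\<lambda>w. (w $ 2, w $ 1)) z))"
    using at_within_open[OF op(2,1)] S(3) by (simp add: blinfun_mult_right.rep_eq)
  moreover have "((\<lambda>w::complex^2. (w $ 2, w $ 1)) has_derivative (\<lambda>w. (w $ 2, w $ 1))) (at z)"
    by (intro has_derivative_Pair bounded_linear_imp_has_derivative bounded_linear_vec_nth)
  ultimately have "((\<lambda>w. k (vector [w $ 1, w $ 2])) has_derivative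
      (\<lambda>h. e * h $ 2 + d (z $ 2, 0) * h $ 1)) (at z)"
    using has_derivative_compose[of "\<lambda>w::complex^2. (w $ 2, w $ 1)"] by (fastforce simp: f_def)
  then show ?thesis
    unfolding has_partials_def
    by (intro exI[of _ "d (z $ 2, 0)"] exI[of _ e]) (simp add: add.commute)
qed

section \<open>Maps from the plane to surfaces\<close>

lemma holomorphic2_on_open: "f holomorphic2_on S \<Longrightarrow> open S"
  by (simp add: holomorphic2_on_def)

lemma holomorphic2_onE:
  assumes "f holomorphic2_on S" "z \<in> S"
  obtains J :: "complex^2^2" where "(f has_derivative (\<lambda>h. J *v h)) (at z)"
  using assms by (auto simp: holomorphic2_on_def)

lemma holomorphic2_on_imp_continuous_on: "f holomorphic2_on S \<Longrightarrow> continuous_on S f"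
  by (meson continuous_at_imp_continuous_on has_derivative_continuous holomorphic2_onE)

lemma holomorphic2_on_subset: "f holomorphic2_on S \<Longrightarrow> open T \<Longrightarrow> T \<subseteq> S \<Longrightarrow> f holomorphic2_on T"
  by (auto simp: holomorphic2_on_def)

lemma has_derivative_mat_compose:
  fixes J K :: "complex^2^2"
  assumes "(f has_derivative (\<lambda>h. J *v h)) (at z)" "(g has_derivative (\<lambda>h. K *v h)) (at (f z))"
  shows "(g \<circ> f has_derivative (\<lambda>h. (K ** J) *v h)) (at z)"
  using has_derivative_compose[OF assms] by (simp add: o_def matrix_vector_mul_assoc)

lemma holomorphic2_on_compose:
  assumes "f holomorphic2_on S" "g holomorphic2_on T" "f ` S \<subseteq> T"
  shows "(g \<circ> f) holomorphic2_on S"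
  unfolding holomorphic2_on_def
proof (intro conjI ballI)
  fix z assume z: "z \<in> S"
  obtain J where "(f has_derivative (\<lambda>h. J *v h)) (at z)" using assms(1) z by (rule holomorphic2_onE)
  moreover obtain K where "(g has_derivative (\<lambda>h. K *v h)) (at (f z))"
    using assms(2,3) z by (meson holomorphic2_onE image_subset_iff)
  ultimately show "\<exists>J. (g \<circ> f has_derivative (\<lambda>h. J *v h)) (at z)"
    using has_derivative_mat_compose by blast
qed (use assms(1) holomorphic2_on_open in blast)

lemma holomorphic2_on_cong:
  assumes "f holomorphic2_on S" "\<And>z. z \<in> S \<Longrightarrow> g z = f z"
  shows "g holomorphic2_on S"
  unfolding holomorphic2_on_def
proof (intro conjI ballI)
  show "open S" using assms(1) by (rule holomorphic2_on_open)
  fix z assume z: "z \<in> S"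
  obtain J where "(f has_derivative (\<lambda>h. J *v h)) (at z)" using assms(1) z by (rule holomorphic2_onE)
  then show "\<exists>J. (g has_derivative (\<lambda>h. J *v h)) (at z)"
    using has_derivative_transform_within_open \<open>open S\<close> z assms(2) by metis
qed

lemma holomorphic2_on_vimage:
  assumes "f holomorphic2_on S" "open T"
  shows "open (S \<inter> f -` T)"
  using assms holomorphic2_on_imp_continuous_on holomorphic2_on_open continuous_open_preimage by blast

text \<open>
  The part of \<^const>\<open>complex_surface\<close> that makes the topology behave; it is all that is
  needed of \<^const>\<open>blowup_C2\<close>.
\<close>

definition charts_ok :: "'a atlas \<Rightarrow> bool" where
  "charts_ok X \<longleftrightarrow> (\<forall>(U, \<phi>)\<in>X. inj_on \<phi> U \<and> (\<forall>(W, \<psi>)\<in>X. open (\<phi> ` (U \<inter> W))))"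

lemma charts_ok_inj: "charts_ok X \<Longrightarrow> (U, \<phi>) \<in> X \<Longrightarrow> inj_on \<phi> U"
  by (auto simp: charts_ok_def)

lemma complex_surface_charts_ok: "complex_surface X \<Longrightarrow> charts_ok X"
  unfolding complex_surface_def charts_ok_def holomorphic2_on_def by blast

lemma complex_surface_transition:
  "complex_surface X \<Longrightarrow> (U, \<phi>) \<in> X \<Longrightarrow> (W, \<psi>) \<in> X \<Longrightarrow>
   (\<psi> \<circ> inv_into U \<phi>) holomorphic2_on (\<phi> ` (U \<inter> W))"
  unfolding complex_surface_def by blast

section \<open>The topology of an atlas and its open subsurfaces\<close>

lemma openin_charts:
  assumes "charts_ok X"
  shows "openin (surface_topology X) S \<longleftrightarrow>
    S \<subseteq> points X \<and> (\<forall>(U, \<phi>)\<in>X. open (\<phi> ` (U \<inter> S)))"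
  by (rule openin_surface_topology) (use assms charts_ok_inj in blast)

lemma openin_chart:
  assumes "charts_ok X" "(U, \<phi>) \<in> X"
  shows "openin (surface_topology X) U"
  using assms by (auto simp: openin_charts points_def charts_ok_def)

lemma topspace_charts:
  assumes "charts_ok X"
  shows "topspace (surface_topology X) = points X"
proof
  show "topspace (surface_topology X) \<subseteq> points X"
    using assms by (simp add: topspace_def openin_charts) blast
  show "points X \<subseteq> topspace (surface_topology X)"
    using openin_subset[OF openin_chart[OF assms]] by (auto simp: points_def)
qed

lemma in_pointsE:
  assumes "x \<in> points X"
  obtains U \<phi> where "(U, \<phi>) \<in> X" "x \<in> U"
  using assms by (auto simp: points_def)

lemma points_restrict [simp]: "points (restrict_surface X S) = points X \<inter> S"
  by (auto simp: points_def restrict_surface_def)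

lemma restrict_surfaceE:
  assumes "(U', \<phi>) \<in> restrict_surface X S"
  obtains U where "(U, \<phi>) \<in> X" "U' = U \<inter> S"
  using assms by (auto simp: restrict_surface_def)

lemma restrict_surfaceI: "(U, \<phi>) \<in> X \<Longrightarrow> (U \<inter> S, \<phi>) \<in> restrict_surface X S"
  by (force simp: restrict_surface_def)

lemma charts_ok_restrict:
  assumes X: "charts_ok X" and S: "openin (surface_topology X) (points X \<inter> S)"
  shows "charts_ok (restrict_surface X S)"
  unfolding charts_ok_def
proof clarify
  fix U' \<phi> assume "(U', \<phi>) \<in> restrict_surface X S"
  then obtain U where U: "(U, \<phi>) \<in> X" "U' = U \<inter> S" by (rule restrict_surfaceE)
  have "open (\<phi> ` (U' \<inter> W'))" if W': "(W', \<psi>) \<in> restrict_surface X S" for W' \<psi>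
  proof -
    obtain W where W: "(W, \<psi>) \<in> X" "W' = W \<inter> S" using W' by (rule restrict_surfaceE)
    have "openin (surface_topology X) (W \<inter> (points X \<inter> S))"
      using S openin_chart[OF X W(1)] by blast
    then have "open (\<phi> ` (U \<inter> (W \<inter> (points X \<inter> S))))"
      using U(1) X by (auto simp: openin_charts)
    moreover have "U \<inter> (W \<inter> (points X \<inter> S)) = U' \<inter> W'"
      using U W by (auto simp: points_def)
    ultimately show ?thesis by simp
  qed
  moreover have "inj_on \<phi> U'"
    using charts_ok_inj[OF X U(1)] U(2) by (auto simp: inj_on_def)
  ultimately show "inj_on \<phi> U' \<and> (\<forall>(W, \<psi>)\<in>restrict_surface X S. open (\<phi> ` (U' \<inter> W)))"
    by blast
qed

lemma openin_restrict:
  assumes X: "charts_ok X" and S: "openin (surface_topology X) (points X \<inter> S)"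
  shows "openin (surface_topology (restrict_surface X S)) A \<longleftrightarrow>
    openin (surface_topology X) A \<and> A \<subseteq> S"
proof -
  have "U \<inter> S \<inter> A = U \<inter> A" if "A \<subseteq> S" for U using that by blast
  moreover have "(\<forall>(U, \<phi>)\<in>restrict_surface X S. open (\<phi> ` (U \<inter> A))) \<longleftrightarrow>
      (\<forall>(U, \<phi>)\<in>X. open (\<phi> ` (U \<inter> S \<inter> A)))"
    by (auto simp: restrict_surface_def)
  ultimately show ?thesis
    unfolding openin_charts[OF charts_ok_restrict[OF assms]] openin_charts[OF X]
    by auto
qed

text \<open>Identifying the topology with a subspace topology is what lets the Hausdorff property
  and second countability be inherited.\<close>

lemma surface_topology_restrict:
  assumes X: "charts_ok X" and S: "openin (surface_topology X) (points X \<inter> S)"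
  shows "surface_topology (restrict_surface X S) = subtopology (surface_topology X) S"
  unfolding topology_eq
proof
  fix A
  have "openin (surface_topology X) (B \<inter> S)" if "openin (surface_topology X) B" for B
  proof -
    have "B \<inter> S = B \<inter> (points X \<inter> S)" using openin_subset[OF that] topspace_charts[OF X] by blast
    then show ?thesis using S that by auto
  qed
  then show "openin (surface_topology (restrict_surface X S)) A \<longleftrightarrow>
      openin (subtopology (surface_topology X) S) A"
    unfolding openin_restrict[OF assms] openin_subtopology by blast
qed

text \<open>A restricted chart keeps its function but shrinks its domain, so the two choices of
  inverse have to be compared.\<close>

lemma inv_into_Int:
  assumes "inj_on \<phi> U" "z \<in> \<phi> ` (U \<inter> S)"
  shows "inv_into (U \<inter> S) \<phi> z = inv_into U \<phi> z"
  using assms by (auto intro!: inv_into_f_eq inj_on_subset[OF assms(1)] simp: inv_into_f_f)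

lemma complex_surface_restrict:
  assumes X: "complex_surface X" and S: "openin (surface_topology X) (points X \<inter> S)"
  shows "complex_surface (restrict_surface X S)"
proof -
  note ok = complex_surface_charts_ok[OF X]
  have ok': "charts_ok (restrict_surface X S)" by (rule charts_ok_restrict[OF ok S])
  have "(\<psi> \<circ> inv_into U' \<phi>) holomorphic2_on (\<phi> ` (U' \<inter> W'))"
    if U': "(U', \<phi>) \<in> restrict_surface X S" and W': "(W', \<psi>) \<in> restrict_surface X S" for U' \<phi> W' \<psi>
  proof -
    obtain U where U: "(U, \<phi>) \<in> X" "U' = U \<inter> S" using U' by (rule restrict_surfaceE)
    obtain W where W: "(W, \<psi>) \<in> X" "W' = W \<inter> S" using W' by (rule restrict_surfaceE)
    have op: "open (\<phi> ` (U' \<inter> W'))" using ok' U' W' by (auto simp: charts_ok_def)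
    have "(\<psi> \<circ> inv_into U \<phi>) holomorphic2_on (\<phi> ` (U' \<inter> W'))"
      by (rule holomorphic2_on_subset[OF complex_surface_transition[OF X U(1) W(1)] op])
        (use U W in auto)
    then show ?thesis
      by (rule holomorphic2_on_cong)
        (use U W inv_into_Int[OF charts_ok_inj[OF ok U(1)]] in auto)
  qed
  then show ?thesis
    using X charts_ok_inj[OF ok']
    unfolding complex_surface_def surface_topology_restrict[OF ok S]
    by (auto intro!: Hausdorff_space_subtopology second_countable_subtopology)
qed

section \<open>Pointwise holomorphy and local isomorphism of maps from the plane\<close>

text \<open>A local notion, so that a total function can be holomorphic on part of the plane with
  arbitrary values elsewhere. One chart containing the image of a neighbourhood suffices;
  \<open>holomorphic_at_chart\<close> passes to any other.\<close>

definition holomorphic_at :: "'a atlas \<Rightarrow> (complex^2 \<Rightarrow> 'a) \<Rightarrow> complex^2 \<Rightarrow> bool" where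
  "holomorphic_at X F z \<longleftrightarrow>
     (\<exists>(U, \<phi>)\<in>X. \<exists>N. open N \<and> z \<in> N \<and> F ` N \<subseteq> U \<and> (\<phi> \<circ> F) holomorphic2_on N)"

text \<open>The property of being a local isomorphism at \<open>z\<close>. It supplies the Jacobian
  condition of domination and, through \<open>regular_at_open_mapping\<close>, that images of
  neighbourhoods are neighbourhoods.\<close>

definition regular_at :: "'a atlas \<Rightarrow> (complex^2 \<Rightarrow> 'a) \<Rightarrow> complex^2 \<Rightarrow> bool" where
  "regular_at X F z \<longleftrightarrow>
     (\<exists>(U, \<phi>)\<in>X. \<exists>N. open N \<and> z \<in> N \<and> F ` N \<subseteq> U \<and> (\<phi> \<circ> F) holomorphic2_on N \<and>
       (\<exists>J :: complex^2^2. (\<phi> \<circ> F has_derivative (\<lambda>h. J *v h)) (at z) \<and> det J \<noteq> 0))"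

lemma holomorphic_atE:
  assumes "holomorphic_at X F z"
  obtains U \<phi> N where "(U, \<phi>) \<in> X" "open N" "z \<in> N" "F ` N \<subseteq> U" "(\<phi> \<circ> F) holomorphic2_on N"
  using assms by (auto simp: holomorphic_at_def)

lemma regular_atE:
  assumes "regular_at X F z"
  obtains U \<phi> N J where "(U, \<phi>) \<in> X" "open N" "z \<in> N" "F ` N \<subseteq> U" "(\<phi> \<circ> F) holomorphic2_on N"
    "(\<phi> \<circ> F has_derivative (\<lambda>h. (J :: complex^2^2) *v h)) (at z)" "det J \<noteq> 0"
  using assms unfolding regular_at_def by blast

lemma holomorphic_atI:
  assumes "(U, \<phi>) \<in> X" "open N" "z \<in> N" "F ` N \<subseteq> U" "(\<phi> \<circ> F) holomorphic2_on N"
  shows "holomorphic_at X F z"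
  using assms unfolding holomorphic_at_def by blast

lemma regular_atI:
  assumes "(U, \<phi>) \<in> X" "open N" "z \<in> N" "F ` N \<subseteq> U" "(\<phi> \<circ> F) holomorphic2_on N"
    "(\<phi> \<circ> F has_derivative (\<lambda>h. (J :: complex^2^2) *v h)) (at z)" "det J \<noteq> 0"
  shows "regular_at X F z"
  using assms unfolding regular_at_def by blast

lemma regular_imp_holomorphic_at: "regular_at X F z \<Longrightarrow> holomorphic_at X F z"
  by (erule regular_atE, rule holomorphic_atI)

lemma holomorphic_at_points: "holomorphic_at X F z \<Longrightarrow> F z \<in> points X"
  by (erule holomorphic_atE) (auto simp: points_def)

lemma holomorphic_at_cong:
  assumes "holomorphic_at X F z" "open M" "z \<in> M" "\<And>w. w \<in> M \<Longrightarrow> G w = F w"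
  shows "holomorphic_at X G z"
proof -
  obtain U \<phi> N where N: "(U, \<phi>) \<in> X" "open N" "z \<in> N" "F ` N \<subseteq> U" "(\<phi> \<circ> F) holomorphic2_on N"
    using assms(1) by (rule holomorphic_atE)
  show ?thesis
  proof (rule holomorphic_atI[of U \<phi> X "M \<inter> N"])
    have "(\<phi> \<circ> F) holomorphic2_on (M \<inter> N)"
      using N assms(2) by (auto intro: holomorphic2_on_subset)
    then show "(\<phi> \<circ> G) holomorphic2_on (M \<inter> N)"
      by (rule holomorphic2_on_cong) (simp add: assms(4))
  qed (use N assms in auto)
qed

lemma regular_at_cong:
  assumes "regular_at X F z" "open M" "z \<in> M" "\<And>w. w \<in> M \<Longrightarrow> G w = F w"
  shows "regular_at X G z"
proof -
  obtain U \<phi> N J where N: "(U, \<phi>) \<in> X" "open N" "z \<in> N" "F ` N \<subseteq> U" "(\<phi> \<circ> F) holomorphic2_on N"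
    and J: "(\<phi> \<circ> F has_derivative (\<lambda>h. (J :: complex^2^2) *v h)) (at z)" "det J \<noteq> 0"
    using assms(1) by (rule regular_atE)
  show ?thesis
  proof (rule regular_atI[of U \<phi> X "M \<inter> N"])
    have "(\<phi> \<circ> F) holomorphic2_on (M \<inter> N)"
      using N assms(2) by (auto intro: holomorphic2_on_subset)
    then show "(\<phi> \<circ> G) holomorphic2_on (M \<inter> N)"
      by (rule holomorphic2_on_cong) (simp add: assms(4))
    show "(\<phi> \<circ> G has_derivative (\<lambda>h. J *v h)) (at z)"
      by (rule has_derivative_transform_within_open[OF J(1) assms(2,3)]) (simp add: assms(4))
  qed (use N J assms in auto)
qed

lemma holomorphic_at_precompose:
  assumes F: "holomorphic_at X F (q z)" and q: "q holomorphic2_on M" "z \<in> M"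
  shows "holomorphic_at X (F \<circ> q) z"
proof -
  obtain U \<phi> N where N: "(U, \<phi>) \<in> X" "open N" "q z \<in> N" "F ` N \<subseteq> U" "(\<phi> \<circ> F) holomorphic2_on N"
    using F by (rule holomorphic_atE)
  have op: "open (M \<inter> q -` N)" using holomorphic2_on_vimage q N by blast
  have "(\<phi> \<circ> F \<circ> q) holomorphic2_on (M \<inter> q -` N)"
    by (rule holomorphic2_on_compose[OF holomorphic2_on_subset[OF q(1) op] N(5)]) auto
  then show ?thesis
    by (intro holomorphic_atI[OF N(1) op]) (use q N in \<open>auto simp: o_assoc\<close>)
qed

lemma regular_at_precompose:
  fixes K :: "complex^2^2"
  assumes F: "regular_at X F (q z)" and q: "q holomorphic2_on M" "z \<in> M"
    and K: "(q has_derivative (\<lambda>h. K *v h)) (at z)" "det K \<noteq> 0"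
  shows "regular_at X (F \<circ> q) z"
proof -
  obtain U \<phi> N J where N: "(U, \<phi>) \<in> X" "open N" "q z \<in> N" "F ` N \<subseteq> U" "(\<phi> \<circ> F) holomorphic2_on N"
    and J: "(\<phi> \<circ> F has_derivative (\<lambda>h. (J :: complex^2^2) *v h)) (at (q z))" "det J \<noteq> 0"
    using F by (rule regular_atE)
  have op: "open (M \<inter> q -` N)" using holomorphic2_on_vimage q N by blast
  have "(\<phi> \<circ> F \<circ> q) holomorphic2_on (M \<inter> q -` N)"
    by (rule holomorphic2_on_compose[OF holomorphic2_on_subset[OF q(1) op] N(5)]) auto
  then show ?thesis
    using has_derivative_mat_compose[OF K(1) J(1)] K(2) J(2)
    by (intro regular_atI[OF N(1) op, where J = "J ** K"])
      (use q N in \<open>auto simp: o_def det_mul\<close>)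
qed

text \<open>Near \<open>z\<close> the composite factors into the chart expression of
  \<open>f\<close> after that of \<open>F\<close>. The factorization is part of the conclusion
  because derivatives are later computed from it.\<close>

lemma holomorphic_at_compose_chart:
  assumes X: "\<And>U \<phi>. (U, \<phi>) \<in> X \<Longrightarrow> inj_on \<phi> U"
    and F: "(U, \<phi>) \<in> X" "open N" "z \<in> N" "F ` N \<subseteq> U" "(\<phi> \<circ> F) holomorphic2_on N"
    and f: "holomorphic_map X Y f" and W: "(W, \<psi>) \<in> Y" "f (F z) \<in> W"
  obtains M where "open M" "z \<in> M" "(f \<circ> F) ` M \<subseteq> W" "(\<psi> \<circ> (f \<circ> F)) holomorphic2_on M"
    "M \<subseteq> N" "\<And>w. w \<in> M \<Longrightarrow> (\<psi> \<circ> (f \<circ> F)) w = ((\<psi> \<circ> f \<circ> inv_into U \<phi>) \<circ> (\<phi> \<circ> F)) w"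
proof
  let ?\<theta> = "\<psi> \<circ> f \<circ> inv_into U \<phi>" and ?P = "\<phi> ` (U \<inter> f -` W)"
  define M where "M = N \<inter> (\<phi> \<circ> F) -` ?P"
  have \<theta>: "?\<theta> holomorphic2_on ?P" using f F(1) W(1) unfolding holomorphic_map_def by blast
  show op: "open M"
    unfolding M_def by (rule holomorphic2_on_vimage[OF F(5) holomorphic2_on_open[OF \<theta>]])
  show "z \<in> M" using F W by (auto simp: M_def)
  show sub: "M \<subseteq> N" by (auto simp: M_def)
  have M: "F w \<in> U \<and> f (F w) \<in> W" if wM: "w \<in> M" for w
  proof -
    obtain u where u: "\<phi> (F w) = \<phi> u" "u \<in> U" "f u \<in> W" and w: "w \<in> N" using wM by (auto simp: M_def)
    have "F w \<in> U" using w F(4) by blast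
    then have "F w = u" using X[OF F(1)] u by (meson inj_onD)
    then show ?thesis using u by simp
  qed
  then show "(f \<circ> F) ` M \<subseteq> W" by auto
  show eq: "(\<psi> \<circ> (f \<circ> F)) w = (?\<theta> \<circ> (\<phi> \<circ> F)) w" if "w \<in> M" for w
    using M[OF that] X[OF F(1)] by simp
  have "(?\<theta> \<circ> (\<phi> \<circ> F)) holomorphic2_on M"
    by (rule holomorphic2_on_compose[OF holomorphic2_on_subset[OF F(5) op sub] \<theta>]) (auto simp: M_def)
  then show "(\<psi> \<circ> (f \<circ> F)) holomorphic2_on M"
    by (rule holomorphic2_on_cong) (rule eq)
qed

lemma holomorphic_at_compose:
  assumes X: "charts_ok X" and Y: "charts_ok Y"
    and F: "holomorphic_at X F z" and f: "holomorphic_map X Y f"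
  shows "holomorphic_at Y (f \<circ> F) z"
proof -
  obtain U \<phi> N where N: "(U, \<phi>) \<in> X" "open N" "z \<in> N" "F ` N \<subseteq> U" "(\<phi> \<circ> F) holomorphic2_on N"
    using F by (rule holomorphic_atE)
  have "f (F z) \<in> points Y"
    using f holomorphic_at_points[OF F] unfolding holomorphic_map_def continuous_map_def
    by (auto simp: topspace_charts X Y)
  then obtain W \<psi> where W: "(W, \<psi>) \<in> Y" "f (F z) \<in> W" by (rule in_pointsE)
  obtain M where "open M" "z \<in> M" "(f \<circ> F) ` M \<subseteq> W" "(\<psi> \<circ> (f \<circ> F)) holomorphic2_on M"
    by (rule holomorphic_at_compose_chart[OF charts_ok_inj[OF X] N f W])
  then show ?thesis by (rule holomorphic_atI[OF W(1)])
qed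

text \<open>The chart expression of the inverse map undoes that of \<open>f\<close>, so the chain
  rule and uniqueness of derivatives give \<open>L ** K = mat 1\<close>. Hence \<open>K\<close> has
  nonzero determinant, and so does \<open>K ** J\<close>.\<close>

lemma regular_at_compose_chart:
  assumes X: "charts_ok X" and Y: "charts_ok Y"
    and F: "regular_at X F z" and f: "biholomorphic_map X Y f" and W: "(W, \<psi>) \<in> Y" "f (F z) \<in> W"
  obtains M J where "open M" "z \<in> M" "(f \<circ> F) ` M \<subseteq> W" "(\<psi> \<circ> (f \<circ> F)) holomorphic2_on M"
    "(\<psi> \<circ> (f \<circ> F) has_derivative (\<lambda>h. (J :: complex^2^2) *v h)) (at z)" "det J \<noteq> 0"
proof -
  obtain U \<phi> N J where N: "(U, \<phi>) \<in> X" "open N" "z \<in> N" "F ` N \<subseteq> U" "(\<phi> \<circ> F) holomorphic2_on N"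
    and J: "(\<phi> \<circ> F has_derivative (\<lambda>h. (J :: complex^2^2) *v h)) (at z)" "det J \<noteq> 0"
    using F by (rule regular_atE)
  obtain g where fh: "holomorphic_map X Y f" and g: "holomorphic_map Y X g"
    "\<And>x. x \<in> points X \<Longrightarrow> g (f x) = x"
    using f by (auto simp: biholomorphic_map_def)
  obtain M where M: "open M" "z \<in> M" "(f \<circ> F) ` M \<subseteq> W" "(\<psi> \<circ> (f \<circ> F)) holomorphic2_on M"
    "M \<subseteq> N" "\<And>w. w \<in> M \<Longrightarrow> (\<psi> \<circ> (f \<circ> F)) w = ((\<psi> \<circ> f \<circ> inv_into U \<phi>) \<circ> (\<phi> \<circ> F)) w"
    by (rule holomorphic_at_compose_chart[OF charts_ok_inj[OF X] N fh W]) auto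
  let ?\<theta> = "\<psi> \<circ> f \<circ> inv_into U \<phi>" and ?P = "\<phi> ` (U \<inter> f -` W)"
  let ?\<eta> = "\<phi> \<circ> g \<circ> inv_into W \<psi>" and ?Q = "\<psi> ` (W \<inter> g -` U)"
  have \<theta>: "?\<theta> holomorphic2_on ?P" using fh N(1) W(1) unfolding holomorphic_map_def by blast
  have \<eta>: "?\<eta> holomorphic2_on ?Q" using g N(1) W(1) unfolding holomorphic_map_def by blast
  have inj: "inj_on \<phi> U" "inj_on \<psi> W" using charts_ok_inj X Y N(1) W(1) by blast+
  have pt: "u \<in> points X" if "u \<in> U" for u using that N(1) by (auto simp: points_def)
  have Fz: "F z \<in> U" using N by auto
  have "?\<eta> (?\<theta> w) = w" if "w \<in> ?P" for w
    using that inj pt by (auto simp: g(2))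
  moreover have mP: "\<phi> (F z) \<in> ?P" using Fz W(2) by blast
  moreover have mQ: "?\<theta> (\<phi> (F z)) \<in> ?Q" using Fz W(2) inj pt g(2) by auto
  obtain K where K: "(?\<theta> has_derivative (\<lambda>h. K *v h)) (at (\<phi> (F z)))"
    using \<theta> mP by (rule holomorphic2_onE)
  obtain L where L: "(?\<eta> has_derivative (\<lambda>h. L *v h)) (at (?\<theta> (\<phi> (F z))))"
    using \<eta> mQ by (rule holomorphic2_onE)
  have "(?\<eta> \<circ> ?\<theta> has_derivative (\<lambda>h. (L ** K) *v h)) (at (\<phi> (F z)))"
    by (rule has_derivative_mat_compose[OF K L])
  ultimately have "((\<lambda>w. w) has_derivative (\<lambda>h. (L ** K) *v h)) (at (\<phi> (F z)))"
    using has_derivative_transform_within_open[OF _ holomorphic2_on_open[OF \<theta>] mP, of "?\<eta> \<circ> ?\<theta>"]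
    by fastforce
  then have "(\<lambda>h. (L ** K) *v h) = (\<lambda>h. h)"
    using has_derivative_unique has_derivative_ident by blast
  then have "L ** K = mat 1" by (simp add: matrix_eq fun_eq_iff)
  then have "det L * det K = 1" by (metis det_I det_mul)
  then have "det K \<noteq> 0" by auto
  have "(?\<theta> \<circ> (\<phi> \<circ> F) has_derivative (\<lambda>h. (K ** J) *v h)) (at z)"
    by (rule has_derivative_mat_compose[OF J(1)]) (use K in simp)
  then have "(\<psi> \<circ> (f \<circ> F) has_derivative (\<lambda>h. (K ** J) *v h)) (at z)"
    by (rule has_derivative_transform_within_open[OF _ M(1,2)]) (use M(6) in simp)
  with that[OF M(1-4)] show ?thesis using \<open>det K \<noteq> 0\<close> J(2) by (simp add: det_mul)
qed

lemma regular_at_compose: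
  assumes X: "charts_ok X" and Y: "charts_ok Y"
    and F: "regular_at X F z" and f: "biholomorphic_map X Y f"
  shows "regular_at Y (f \<circ> F) z"
proof -
  have "f (F z) \<in> points Y"
    using f holomorphic_at_points[OF regular_imp_holomorphic_at[OF F]]
    unfolding biholomorphic_map_def holomorphic_map_def continuous_map_def
    by (auto simp: topspace_charts X Y)
  then obtain W \<psi> where W: "(W, \<psi>) \<in> Y" "f (F z) \<in> W" by (rule in_pointsE)
  obtain M J where "open M" "z \<in> M" "(f \<circ> F) ` M \<subseteq> W" "(\<psi> \<circ> (f \<circ> F)) holomorphic2_on M"
    "(\<psi> \<circ> (f \<circ> F) has_derivative (\<lambda>h. (J :: complex^2^2) *v h)) (at z)" "det J \<noteq> 0"
    by (rule regular_at_compose_chart[OF X Y F f W])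
  then show ?thesis by (rule regular_atI[OF W(1)])
qed

lemma holomorphic_map_id:
  assumes "complex_surface X"
  shows "holomorphic_map X X id"
  using complex_surface_transition[OF assms] unfolding holomorphic_map_def by auto

section \<open>Continuity, passage to open subsurfaces, and open images\<close>

lemma openin_chart_vimage:
  assumes X: "complex_surface X" and U: "(U, \<phi>) \<in> X" and I: "open I"
  shows "openin (surface_topology X) (U \<inter> \<phi> -` I)"
  unfolding openin_charts[OF complex_surface_charts_ok[OF X]]
proof (intro conjI ballI)
  show "U \<inter> \<phi> -` I \<subseteq> points X" using U by (auto simp: points_def)
  fix c assume "c \<in> X"
  then obtain W \<psi> where W: "c = (W, \<psi>)" "(W, \<psi>) \<in> X" by (cases c) auto
  have "open (\<psi> ` (W \<inter> U) \<inter> (\<phi> \<circ> inv_into W \<psi>) -` I)"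
    by (rule holomorphic2_on_vimage[OF complex_surface_transition[OF X W(2) U] I])
  moreover have "\<psi> ` (W \<inter> U) \<inter> (\<phi> \<circ> inv_into W \<psi>) -` I = \<psi> ` (W \<inter> (U \<inter> \<phi> -` I))"
    using charts_ok_inj[OF complex_surface_charts_ok[OF X] W(2)] by auto
  ultimately show "case c of (W, \<psi>) \<Rightarrow> open (\<psi> ` (W \<inter> (U \<inter> \<phi> -` I)))"
    using W by simp
qed

lemma holomorphic_at_continuous:
  assumes X: "charts_ok X" and F: "holomorphic_at X F z"
    and T: "openin (surface_topology X) T" "F z \<in> T"
  obtains N where "open N" "z \<in> N" "F ` N \<subseteq> T"
proof -
  obtain U \<phi> N where N: "(U, \<phi>) \<in> X" "open N" "z \<in> N" "F ` N \<subseteq> U" "(\<phi> \<circ> F) holomorphic2_on N"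
    using F by (rule holomorphic_atE)
  have "open (\<phi> ` (U \<inter> T))" using T(1) N(1) by (auto simp: openin_charts[OF X])
  then have "open (N \<inter> (\<phi> \<circ> F) -` \<phi> ` (U \<inter> T))" using N(5) by (intro holomorphic2_on_vimage)
  moreover have "F w \<in> T" if "w \<in> N" "\<phi> (F w) \<in> \<phi> ` (U \<inter> T)" for w
    using that N(4) charts_ok_inj[OF X N(1)] by (metis IntE image_subset_iff inj_on_image_mem_iff inf_le1)
  ultimately show ?thesis
    using N T(2) by (intro that[of "N \<inter> (\<phi> \<circ> F) -` \<phi> ` (U \<inter> T)"]) auto
qed

text \<open>Changing the chart is composition with the identity map, which is holomorphic by
  compatibility of the charts.\<close>

lemma holomorphic_at_chart:
  assumes X: "complex_surface X" and F: "holomorphic_at X F z" and W: "(W, \<psi>) \<in> X" "F z \<in> W"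
  obtains M where "open M" "z \<in> M" "F ` M \<subseteq> W" "(\<psi> \<circ> F) holomorphic2_on M"
proof -
  obtain U \<phi> N where N: "(U, \<phi>) \<in> X" "open N" "z \<in> N" "F ` N \<subseteq> U" "(\<phi> \<circ> F) holomorphic2_on N"
    using F by (rule holomorphic_atE)
  show ?thesis
    by (rule holomorphic_at_compose_chart[OF charts_ok_inj[OF complex_surface_charts_ok[OF X]]
          N holomorphic_map_id[OF X] W(1)]) (use W(2) that in auto)
qed

lemma holomorphic_at_restrictD: "holomorphic_at (restrict_surface X S) F z \<Longrightarrow> holomorphic_at X F z"
  by (elim holomorphic_atE restrict_surfaceE) (auto intro: holomorphic_atI)

lemma regular_at_restrictD: "regular_at (restrict_surface X S) F z \<Longrightarrow> regular_at X F z"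
  by (elim regular_atE restrict_surfaceE) (auto intro: regular_atI)

lemma holomorphic_at_restrictI:
  assumes X: "charts_ok X" and F: "holomorphic_at X F z"
    and S: "openin (surface_topology X) (points X \<inter> S)" "F z \<in> S"
  shows "holomorphic_at (restrict_surface X S) F z"
proof -
  obtain U \<phi> N where N: "(U, \<phi>) \<in> X" "open N" "z \<in> N" "F ` N \<subseteq> U" "(\<phi> \<circ> F) holomorphic2_on N"
    using F by (rule holomorphic_atE)
  obtain M where M: "open M" "z \<in> M" "F ` M \<subseteq> points X \<inter> S"
    using holomorphic_at_continuous[OF X F S(1)] S(2) holomorphic_at_points[OF F] by blast
  show ?thesis
  proof (rule holomorphic_atI[OF restrict_surfaceI[OF N(1)]])
    show "(\<phi> \<circ> F) holomorphic2_on (N \<inter> M)" using N M by (intro holomorphic2_on_subset[OF N(5)]) auto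
  qed (use N M in auto)
qed

lemma regular_at_restrictI:
  assumes X: "charts_ok X" and F: "regular_at X F z"
    and S: "openin (surface_topology X) (points X \<inter> S)" "F z \<in> S"
  shows "regular_at (restrict_surface X S) F z"
proof -
  obtain U \<phi> N J where N: "(U, \<phi>) \<in> X" "open N" "z \<in> N" "F ` N \<subseteq> U" "(\<phi> \<circ> F) holomorphic2_on N"
    and J: "(\<phi> \<circ> F has_derivative (\<lambda>h. (J :: complex^2^2) *v h)) (at z)" "det J \<noteq> 0"
    using F by (rule regular_atE)
  note h = regular_imp_holomorphic_at[OF F]
  obtain M where M: "open M" "z \<in> M" "F ` M \<subseteq> points X \<inter> S"
    using holomorphic_at_continuous[OF X h S(1)] S(2) holomorphic_at_points[OF h] by blast
  show ?thesis
  proof (rule regular_atI[OF restrict_surfaceI[OF N(1)]])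
    show "(\<phi> \<circ> F) holomorphic2_on (N \<inter> M)" using N M by (intro holomorphic2_on_subset[OF N(5)]) auto
  qed (use N M J in auto)
qed

text \<open>Sussmann's open mapping theorem works with the derivative at a single point and a right
  inverse of it. The open set \<open>T\<close> inside the image will separate the lift from the
  proper transform.\<close>

lemma regular_at_open_mapping:
  assumes X: "complex_surface X" and F: "regular_at X F z" and M: "open M" "z \<in> M"
  obtains T where "openin (surface_topology X) T" "F z \<in> T" "T \<subseteq> F ` M"
proof -
  obtain U \<phi> N J where N: "(U, \<phi>) \<in> X" "open N" "z \<in> N" "F ` N \<subseteq> U" "(\<phi> \<circ> F) holomorphic2_on N"
    and J: "(\<phi> \<circ> F has_derivative (\<lambda>h. (J :: complex^2^2) *v h)) (at z)" "det J \<noteq> 0"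
    using F by (rule regular_atE)
  obtain K where K: "J ** K = mat 1"
    using J(2) by (metis invertible_det_nz invertible_def)
  define I where "I = interior ((\<phi> \<circ> F) ` (N \<inter> M))"
  have I: "(\<phi> \<circ> F) z \<in> I"
    unfolding I_def
  proof (rule sussmann_open_mapping[OF N(2) holomorphic2_on_imp_continuous_on[OF N(5)] N(3) J(1)])
    show "bounded_linear (\<lambda>h. K *v h)" by (rule matrix_vector_mul_bounded_linear)
    show "(\<lambda>h. J *v h) \<circ> (\<lambda>h. K *v h) = id"
      using K by (simp add: fun_eq_iff matrix_vector_mul_assoc)
  qed (use N M in \<open>auto simp: interior_open\<close>)
  show ?thesis
  proof (rule that[of "U \<inter> \<phi> -` I"])
    show "openin (surface_topology X) (U \<inter> \<phi> -` I)"
      by (rule openin_chart_vimage[OF X N(1)]) (simp add: I_def)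
    show "F z \<in> U \<inter> \<phi> -` I" using I N by auto
    show "U \<inter> \<phi> -` I \<subseteq> F ` M"
    proof
      fix y assume y: "y \<in> U \<inter> \<phi> -` I"
      then obtain w where w: "w \<in> N \<inter> M" "\<phi> y = \<phi> (F w)"
        using interior_subset unfolding I_def by fastforce
      then have "y = F w"
        using charts_ok_inj[OF complex_surface_charts_ok[OF X] N(1)] y N(4) by (auto dest: inj_onD)
      then show "y \<in> F ` M" using w by blast
    qed
  qed
qed

section \<open>The plane as a surface\<close>

lemma charts_ok_C2: "charts_ok C2"
  by (simp add: charts_ok_def C2_def)

lemma openin_C2: "openin (surface_topology C2) S \<longleftrightarrow> open S"
  using openin_charts[OF charts_ok_C2] by (simp add: C2_def points_def)

lemma points_C2: "points C2 = UNIV"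
  by (simp add: C2_def points_def)

lemma topspace_C2: "topspace (surface_topology C2) = UNIV"
  using topspace_charts[OF charts_ok_C2] by (simp add: points_C2)

lemma holomorphic_at_C2: "holomorphic_at C2 F z \<longleftrightarrow> (\<exists>N. z \<in> N \<and> F holomorphic2_on N)"
  using holomorphic2_on_open by (auto simp: holomorphic_at_def C2_def)

text \<open>Local continuity makes preimages of open sets open, which yields both the global
  continuity and the open domains that \<open>holomorphic_map\<close> demands.\<close>

lemma holomorphic_map_C2:
  assumes X: "complex_surface X" and F: "\<And>z. holomorphic_at X F z"
  shows "holomorphic_map C2 X F"
proof -
  note ok = complex_surface_charts_ok[OF X]
  have op: "open (F -` T)" if T: "openin (surface_topology X) T" for T
  proof (subst open_subopen, intro ballI)
    fix z assume "z \<in> F -` T"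
    then have "F z \<in> T" by simp
    then obtain N where "open N" "z \<in> N" "F ` N \<subseteq> T"
      by (rule holomorphic_at_continuous[OF ok F T])
    then show "\<exists>N. open N \<and> z \<in> N \<and> N \<subseteq> F -` T" by blast
  qed
  have "\<exists>J. (\<psi> \<circ> F has_derivative (\<lambda>h. (J :: complex^2^2) *v h)) (at z)"
    if "(W, \<psi>) \<in> X" "F z \<in> W" for W \<psi> z
    using holomorphic_at_chart[OF X F that] holomorphic2_onE by metis
  moreover have "continuous_map (surface_topology C2) (surface_topology X) F"
    unfolding continuous_map_def
    using op holomorphic_at_points[OF F] topspace_charts[OF ok]
    by (auto simp: openin_C2 topspace_C2 vimage_def)
  ultimately show ?thesis
    using op[OF openin_chart[OF ok]]
    by (auto simp: holomorphic_map_def C2_def[abs_def] holomorphic2_on_def inv_id)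
qed

section \<open>The blow-up of the plane\<close>

lemma has_partials_continuous: "has_partials f z p q \<Longrightarrow> isCont f z"
  unfolding has_partials_def by (rule has_derivative_continuous)

lemma has_derivative_vector2:
  assumes "has_partials f z p q" "has_partials g z p' q'"
  shows "((\<lambda>w. vector [f w, g w] :: complex^2) has_derivative
    (\<lambda>h. (vector [vector [p, q], vector [p', q']] :: complex^2^2) *v h)) (at z)"
  unfolding has_derivative_vec2_iff using assms by simp

lemma det_vector2: "det (vector [vector [p, q], vector [p', q']] :: complex^2^2) = p * q' - q * p'"
  by (simp add: det_2)

lemma holomorphic2_on_vector2:
  assumes "open S" "\<And>z. z \<in> S \<Longrightarrow> \<exists>p q. has_partials f z p q" "\<And>z. z \<in> S \<Longrightarrow> \<exists>p q. has_partials g z p q"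
  shows "(\<lambda>w. vector [f w, g w]) holomorphic2_on S"
  unfolding holomorphic2_on_def using assms has_derivative_vector2 by meson

text \<open>The value \<open>c\<close> on the line is the first partial derivative of
  \<open>h\<close>, so on each horizontal slice the quotient is a difference quotient at 0 with its
  singularity removed. Off the line it is an ordinary quotient, hence continuous;
  \<open>has_partials_removable\<close> then gives the total derivative on the line.\<close>

lemma has_partials_quotient:
  fixes h :: "complex^2 \<Rightarrow> complex"
  assumes M: "open M" and h: "\<And>w. w \<in> M \<Longrightarrow> \<exists>p q. has_partials h w p q"
    and h0: "\<And>w. w \<in> M \<Longrightarrow> w $ 1 = 0 \<Longrightarrow> h w = 0"
    and c: "\<And>w. w \<in> M \<Longrightarrow> w $ 1 = 0 \<Longrightarrow> \<exists>q. has_partials h w (c (w $ 2)) q"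
    and c': "\<And>y. c field_differentiable at y" and w: "w \<in> M"
  shows "\<exists>p q. has_partials (\<lambda>w. if w $ 1 = 0 then c (w $ 2) else h w / w $ 1) w p q"
proof -
  define k where "k = (\<lambda>w::complex^2. if w $ 1 = 0 then c (w $ 2) else h w / w $ 1)"
  have op: "open {w::complex^2. w $ 1 \<noteq> 0}"
    by (intro open_Collect_neq continuous_intros)
  have off: "\<exists>p q. has_partials k w p q" if "w \<in> M" "w $ 1 \<noteq> 0" for w
  proof -
    obtain p q where "has_partials h w p q" using h \<open>w \<in> M\<close> by blast
    from has_partials_cong[OF has_partials_divide[OF this has_partials_nth(1) that(2)] op, of k]
    show ?thesis using that by (auto simp: k_def)
  qed
  have "\<exists>p q. has_partials k w p q" if wM: "w \<in> M" and w0: "w $ 1 = 0"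
  proof (rule has_partials_removable[OF M wM w0])
    fix v assume v: "v \<in> M"
    show "(\<lambda>x. k (vector [x, v $ 2])) field_differentiable at (v $ 1)"
    proof (cases "v $ 1 = 0")
      case False
      obtain p q where "has_partials k v p q" using off[OF v False] by blast
      then show ?thesis
        using has_partials_imp_slices(1) field_differentiable_def by blast
    next
      case True
      define f where "f = (\<lambda>x. h (vector [x, v $ 2]))"
      define A where "A = (\<lambda>x. vector [x, v $ 2]) -` M"
      have A: "open A"
        unfolding A_def by (intro open_vimage M continuous_on_vector2 continuous_intros)
      have v0: "vector [0, v $ 2] = v" using vector2_eta[of v] True by simp
      have "f holomorphic_on A"
      proof (rule holomorphic_onI)
        fix x assume "x \<in> A"
        then have "vector [x, v $ 2] \<in> M" by (simp add: A_def)
        then obtain p q where "has_partials h (vector [x, v $ 2]) p q" using h by blast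
        from has_partials_imp_slices(1)[OF this]
        show "f field_differentiable at x within A"
          by (auto simp: f_def field_differentiable_def intro: has_field_derivative_at_within)
      qed
      \<comment> \<open>The difference quotient of \<open>f\<close> at 0, completed by
        \<open>deriv f 0\<close>, is holomorphic; the hypothesis on \<open>c\<close> identifies that
        value.\<close>
      from pole_lemma_open[OF this A, of 0]
      have fd: "(\<lambda>x. if x = 0 then deriv f 0 else (f x - f 0) / (x - 0)) field_differentiable at 0"
      proof (rule holomorphic_on_imp_differentiable_at[OF _ A])
        show "0 \<in> A" using v v0 by (simp add: A_def)
      qed
      obtain q where "has_partials h v (c (v $ 2)) q" using c v True by blast
      from has_partials_imp_slices(1)[OF this] have df: "deriv f 0 = c (v $ 2)"
        unfolding True f_def by (rule DERIV_imp_deriv)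
      have f0: "f 0 = 0" using h0 v True v0 by (simp add: f_def)
      have "(\<lambda>x. if x = 0 then c (v $ 2) else f x / x) field_differentiable at 0"
        using fd unfolding df f0 diff_0_right .
      moreover have "(\<lambda>x. k (vector [x, v $ 2])) = (\<lambda>x. if x = 0 then c (v $ 2) else f x / x)"
        by (auto simp: k_def f_def)
      ultimately show ?thesis by (simp add: True)
    qed
  next
    show "(\<lambda>y. k (vector [0, y])) field_differentiable at (w $ 2)"
      using c' by (simp add: k_def)
    show "continuous_on (M \<inter> {w. w $ 1 \<noteq> 0}) k"
      using off has_partials_continuous
      by (intro continuous_at_imp_continuous_on) blast
  qed
  then show ?thesis using off w unfolding k_def by blast
qed

text \<open>
  In coordinates \<open>(x, y)\<close> in which the derivative of \<open>\<psi>\<close> at \<open>(0, s0)\<close> is the identity, the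
  direction of \<open>\<psi> (x, s0 + x s)\<close> tends to \<open>[1 : s]\<close> as \<open>x \<rightarrow> 0\<close>.
\<close>

lemma blowup_lift_coordinates:
  fixes \<psi> :: "complex^2 \<Rightarrow> complex^2" and A :: "complex^2^2"
  assumes \<psi>: "\<psi> holomorphic2_on N" and s0: "vector [0, s0] \<in> N" "\<psi> (vector [0, s0]) = 0"
    and A: "(\<psi> has_derivative (\<lambda>h. A *v h)) (at (vector [0, s0]))" "det A \<noteq> 0"
  obtains M R where "open M" "\<And>w. w $ 1 = 0 \<Longrightarrow> w \<in> M"
    "\<And>w. w \<in> M \<Longrightarrow> vector [w $ 1, s0 + w $ 1 * w $ 2] \<in> N"
    "R holomorphic2_on M"
    "\<And>w. w \<in> M \<Longrightarrow> A *v vector [R w $ 1, R w $ 1 * R w $ 2] = \<psi> (vector [w $ 1, s0 + w $ 1 * w $ 2])"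
    "\<And>w. w $ 1 = 0 \<Longrightarrow> R w = w"
    "\<And>w. w $ 1 = 0 \<Longrightarrow> \<exists>J::complex^2^2. (R has_derivative (\<lambda>h. J *v h)) (at w) \<and> det J \<noteq> 0"
proof -
  define q :: "complex^2 \<Rightarrow> complex^2" where "q = (\<lambda>w. vector [w $ 1, s0 + w $ 1 * w $ 2])"
  have q': "(q has_derivative (\<lambda>h. (vector [vector [1, 0], vector [w $ 2, w $ 1]] :: complex^2^2) *v h)) (at w)" for w
    unfolding q_def
  proof (rule has_derivative_vector2[OF has_partials_nth(1)])
    show "has_partials (\<lambda>w. s0 + w $ 1 * w $ 2) w (w $ 2) (w $ 1)"
      using has_partials_add[OF has_partials_const[of s0] has_partials_mult[OF has_partials_nth(1) has_partials_nth(2)]]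
      by simp
  qed
  have q: "q holomorphic2_on UNIV" unfolding holomorphic2_on_def using q' by blast
  define P where "P = q -` N"
  have P: "open P"
    unfolding P_def using holomorphic2_on_vimage[OF q holomorphic2_on_open[OF \<psi>]] by simp
  have q0: "q w = vector [0, s0]" if "w $ 1 = 0" for w using that by (simp add: q_def)
  have P0: "w \<in> P" if "w $ 1 = 0" for w using q0[OF that] s0 by (simp add: P_def)
  \<comment> \<open>Composing with the inverse of \<open>A\<close> makes the derivative of the plane
    map at \<open>(0, s0)\<close> the identity.\<close>
  obtain B where B: "A ** B = mat 1" "B ** A = mat 1"
    using A(2) by (metis invertible_det_nz invertible_def)
  define H where "H = (\<lambda>w. B *v w) \<circ> (\<psi> \<circ> q)"
  have B': "((\<lambda>w. B *v w) has_derivative (\<lambda>h. B *v h)) (at w)" for w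
    by (intro bounded_linear_imp_has_derivative matrix_vector_mul_bounded_linear)
  have H: "H holomorphic2_on P"
    unfolding H_def
    by (intro holomorphic2_on_compose[of _ _ _ UNIV] holomorphic2_on_compose[of q _ \<psi> N]
        holomorphic2_on_subset[OF q P] \<psi>) (use B' in \<open>auto simp: holomorphic2_on_def P_def\<close>)
  have AH: "A *v H w = \<psi> (q w)" for w
    by (simp add: H_def matrix_vector_mul_assoc B)
  have H0: "H w = 0" if "w $ 1 = 0" for w
    using q0[OF that] s0 by (simp add: H_def matrix_vector_mult_0_right)
  \<comment> \<open>To first order at a point \<open>(0, s)\<close>, \<open>H\<close> is
    \<open>(x, s x)\<close>. After division by \<open>x\<close> its components therefore take the
    values 1 and \<open>s\<close> on the line, which are those prescribed for \<open>k1\<close> and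
    \<open>k2\<close>.\<close>
  have H': "(H has_derivative (\<lambda>h. (vector [vector [1, 0], vector [w $ 2, 0]] :: complex^2^2) *v h)) (at w)"
    if "w $ 1 = 0" for w
  proof -
    have "(\<psi> \<circ> q has_derivative
        (\<lambda>h. (A ** vector [vector [1, 0], vector [w $ 2, w $ 1]]) *v h)) (at w)"
      by (rule has_derivative_mat_compose[OF q']) (use A(1) q0[OF that] in simp)
    from has_derivative_mat_compose[OF this B'] show ?thesis
      unfolding H_def by (simp add: matrix_mul_assoc B that)
  qed
  have H1: "has_partials (\<lambda>w. H w $ 1) w 1 0" and H2: "has_partials (\<lambda>w. H w $ 2) w (w $ 2) 0"
    if "w $ 1 = 0" for w
    using H'[OF that, unfolded has_derivative_vec2_iff] by simp_all
  have Hp: "(\<exists>p q. has_partials (\<lambda>w. H w $ 1) w p q) \<and> (\<exists>p q. has_partials (\<lambda>w. H w $ 2) w p q)"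
    if "w \<in> P" for w
    using H that unfolding holomorphic2_on_def has_derivative_vec2_iff by blast
  define k1 where "k1 = (\<lambda>w::complex^2. if w $ 1 = 0 then 1 else H w $ 1 / w $ 1)"
  define k2 where "k2 = (\<lambda>w::complex^2. if w $ 1 = 0 then w $ 2 else H w $ 2 / w $ 1)"
  have k1: "\<exists>p q. has_partials k1 w p q" if "w \<in> P" for w
    unfolding k1_def
    by (rule has_partials_quotient[OF P, where c = "\<lambda>_. 1"])
      (use Hp H0 H1 that in \<open>auto simp: field_differentiable_const\<close>)
  have k2: "\<exists>p q. has_partials k2 w p q" if "w \<in> P" for w
    unfolding k2_def
    by (rule has_partials_quotient[OF P, where c = "\<lambda>y. y"])
      (use Hp H0 H2 that in \<open>auto simp: field_differentiable_ident\<close>)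
  \<comment> \<open>The direction of \<open>H\<close> is \<open>[k1 : k2]\<close>; zeros of
    \<open>k1\<close> are removed so that it stays in the chart \<open>[1 : t]\<close>.\<close>
  define M where "M = P \<inter> k1 -` (- {0})"
  have "continuous_on P k1"
    using k1 has_partials_continuous by (intro continuous_at_imp_continuous_on) blast
  then have M: "open M" unfolding M_def by (intro continuous_open_preimage P) auto
  \<comment> \<open>This is \<open>H\<close> in the first blow-up chart: the quotient of its
    components, written as \<open>k2 / k1\<close> to make sense on the line.\<close>
  define R :: "complex^2 \<Rightarrow> complex^2" where "R = (\<lambda>w. vector [H w $ 1, k2 w / k1 w])"
  have M0: "w \<in> M" if "w $ 1 = 0" for w using P0[OF that] that by (simp add: M_def k1_def)
  have R2: "\<exists>p q. has_partials (\<lambda>w. k2 w / k1 w) w p q" if "w \<in> M" for w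
    using k1[of w] k2[of w] that has_partials_divide[of k2 w _ _ k1] unfolding M_def by blast
  show ?thesis
  proof (rule that[OF M M0])
    show "vector [w $ 1, s0 + w $ 1 * w $ 2] \<in> N" if "w \<in> M" for w
      using that by (simp add: M_def P_def q_def)
    show "R holomorphic2_on M"
      unfolding R_def by (rule holomorphic2_on_vector2[OF M _ R2]) (use Hp in \<open>auto simp: M_def\<close>)
    show "A *v vector [R w $ 1, R w $ 1 * R w $ 2] = \<psi> (vector [w $ 1, s0 + w $ 1 * w $ 2])"
      if "w \<in> M" for w
    proof -
      have "R w $ 1 * R w $ 2 = H w $ 2"
        using that H0[of w] by (auto simp: R_def k1_def k2_def M_def split: if_splits)
      then have "vector [R w $ 1, R w $ 1 * R w $ 2] = H w"
        by (simp add: R_def)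
      then show ?thesis using AH[of w] by (simp add: q_def)
    qed
    show R0: "R w = w" if "w $ 1 = 0" for w
      using that H0[OF that] vector2_eta[of w] by (simp add: R_def k1_def k2_def)
    show "\<exists>J::complex^2^2. (R has_derivative (\<lambda>h. J *v h)) (at w) \<and> det J \<noteq> 0"
      if w0: "w $ 1 = 0" for w
    proof -
      obtain p r where pr: "has_partials (\<lambda>w. k2 w / k1 w) w p r" using R2 M0[OF w0] by blast
      \<comment> \<open>\<open>R\<close> is the identity on the line, which forces
        \<open>r = 1\<close>. The derivative is then lower triangular with determinant 1, whatever
        \<open>p\<close> is.\<close>
      have "((\<lambda>y::complex. y) has_field_derivative r) (at (w $ 2))"
        using has_partials_imp_slices(2)[OF pr] by (simp add: w0 k1_def k2_def)
      then have "r = 1" using DERIV_unique DERIV_ident by blast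
      then show ?thesis
        using has_derivative_vector2[OF H1[OF w0] pr]
        unfolding R_def by (intro exI[of _ "vector [vector [1, 0], vector [p, r]]"]) (simp add: det_vector2)
    qed
  qed auto
qed

section \<open>Lines through the origin and the charts of the blow-up\<close>

lemma cline_scale:
  assumes "c \<noteq> 0"
  shows "cline (c *s v) = cline v"
proof
  show "cline (c *s v) \<subseteq> cline v" by (auto simp: cline_def vector_smult_assoc)
  have "d *s v = (d / c) *s (c *s v)" for d using assms by (simp add: vector_smult_assoc)
  then show "cline v \<subseteq> cline (c *s v)" unfolding cline_def by blast
qed

lemma cline_vector2:
  shows "a \<noteq> 0 \<Longrightarrow> cline (vector [a, b]) = cline (vector [1, b / a])"
    and "b \<noteq> 0 \<Longrightarrow> cline (vector [a, b]) = cline (vector [a / b, 1])"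
proof -
  have "(vector [a, b] :: complex^2) = a *s vector [1, b / a]" if "a \<noteq> 0"
    using that by (simp add: vec_eq_iff forall_2)
  then show "a \<noteq> 0 \<Longrightarrow> cline (vector [a, b]) = cline (vector [1, b / a])"
    by (simp add: cline_scale)
  have "(vector [a, b] :: complex^2) = b *s vector [a / b, 1]" if "b \<noteq> 0"
    using that by (simp add: vec_eq_iff forall_2)
  then show "b \<noteq> 0 \<Longrightarrow> cline (vector [a, b]) = cline (vector [a / b, 1])"
    by (simp add: cline_scale)
qed

lemma cline_eqD:
  assumes "cline v = cline w"
  shows "\<exists>c. v = c *s w"
proof -
  have "1 *s v \<in> cline v" unfolding cline_def by blast
  then show ?thesis using assms by (auto simp: cline_def)
qed

lemma inj_blowup_par: "inj blowup_par1" "inj blowup_par2"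
proof -
  show "inj blowup_par1"
  proof (rule injI)
    fix v w assume eq: "blowup_par1 v = blowup_par1 w"
    then have "cline (vector [1, v $ 2]) = cline (vector [1, w $ 2])" by (simp add: blowup_par1_def)
    then obtain c where "(vector [1, v $ 2] :: complex^2) = c *s vector [1, w $ 2]" using cline_eqD by blast
    then have "v $ 2 = w $ 2" by (simp add: vec_eq_iff forall_2)
    moreover have "v $ 1 = w $ 1" using eq by (simp add: blowup_par1_def vec_eq_iff forall_2)
    ultimately show "v = w" by (simp add: vec_eq_iff forall_2)
  qed
  show "inj blowup_par2"
  proof (rule injI)
    fix v w assume eq: "blowup_par2 v = blowup_par2 w"
    then have "cline (vector [v $ 1, 1]) = cline (vector [w $ 1, 1])" by (simp add: blowup_par2_def)
    then obtain c where "(vector [v $ 1, 1] :: complex^2) = c *s vector [w $ 1, 1]" using cline_eqD by blast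
    then have "v $ 1 = w $ 1" by (simp add: vec_eq_iff forall_2)
    moreover have "v $ 2 = w $ 2" using eq by (simp add: blowup_par2_def vec_eq_iff forall_2)
    ultimately show "v = w" by (simp add: vec_eq_iff forall_2)
  qed
qed

text \<open>The charts are inverses of parametrizations, so openness in a chart becomes openness of
  a preimage under the parametrization.\<close>

lemma inv_image_range: "inj f \<Longrightarrow> inv f ` (range f \<inter> S) = f -` S"
  by (auto simp: image_iff) (metis IntI inv_f_f rangeI)

lemma blowup_par1_in_range2: "blowup_par1 w \<in> range blowup_par2 \<longleftrightarrow> w $ 2 \<noteq> 0"
proof
  assume "blowup_par1 w \<in> range blowup_par2"
  then obtain v :: "complex^2" where "cline (vector [1, w $ 2]) = cline (vector [v $ 1, 1])"
    by (auto simp: blowup_par1_def blowup_par2_def)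
  then obtain c where "(vector [1, w $ 2] :: complex^2) = c *s vector [v $ 1, 1]" using cline_eqD by blast
  then show "w $ 2 \<noteq> 0" by (auto simp: vec_eq_iff forall_2)
next
  assume w: "w $ 2 \<noteq> 0"
  have "blowup_par1 w = blowup_par2 (vector [1 / w $ 2, w $ 1 * w $ 2])"
    using cline_vector2(2)[OF w, of 1] w
    by (simp add: blowup_par1_def blowup_par2_def vec_eq_iff forall_2)
  then show "blowup_par1 w \<in> range blowup_par2" by simp
qed

lemma blowup_par2_in_range1: "blowup_par2 w \<in> range blowup_par1 \<longleftrightarrow> w $ 1 \<noteq> 0"
proof
  assume "blowup_par2 w \<in> range blowup_par1"
  then obtain v :: "complex^2" where "cline (vector [w $ 1, 1]) = cline (vector [1, v $ 2])"
    by (auto simp: blowup_par1_def blowup_par2_def)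
  then obtain c where "(vector [w $ 1, 1] :: complex^2) = c *s vector [1, v $ 2]" using cline_eqD by blast
  then show "w $ 1 \<noteq> 0" by (auto simp: vec_eq_iff forall_2)
next
  assume w: "w $ 1 \<noteq> 0"
  have "blowup_par2 w = blowup_par1 (vector [w $ 1 * w $ 2, 1 / w $ 1])"
    using cline_vector2(1)[OF w, of 1] w
    by (simp add: blowup_par1_def blowup_par2_def vec_eq_iff forall_2)
  then show "blowup_par2 w \<in> range blowup_par1" by simp
qed

lemma charts_ok_blowup: "charts_ok blowup_C2"
proof -
  have "open {w::complex^2. w $ 2 \<noteq> 0}" "open {w::complex^2. w $ 1 \<noteq> 0}"
    by (intro open_Collect_neq continuous_intros)+
  then show ?thesis
    using inv_image_range[OF inj_blowup_par(1), of UNIV] inv_image_range[OF inj_blowup_par(2), of UNIV]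
      inv_image_range[OF inj_blowup_par(1), of "range blowup_par2"]
      inv_image_range[OF inj_blowup_par(2), of "range blowup_par1"]
    by (auto simp: charts_ok_def blowup_C2_def vimage_def blowup_par1_in_range2 blowup_par2_in_range1
        intro: inj_on_inv_into)
qed

lemma points_blowup: "points blowup_C2 = range blowup_par1 \<union> range blowup_par2"
  by (auto simp: points_def blowup_C2_def)

lemma openin_blowup_fst:
  assumes "open W"
  shows "openin (surface_topology blowup_C2) (points blowup_C2 \<inter> fst -` W)"
proof -
  have "open (blowup_par1 -` (points blowup_C2 \<inter> fst -` W))"
    "open (blowup_par2 -` (points blowup_C2 \<inter> fst -` W))"
  proof -
    have "blowup_par1 -` (points blowup_C2 \<inter> fst -` W) = (\<lambda>w. vector [w $ 1, w $ 1 * w $ 2]) -` W"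
      "blowup_par2 -` (points blowup_C2 \<inter> fst -` W) = (\<lambda>w. vector [w $ 1 * w $ 2, w $ 2]) -` W"
      by (auto simp: points_blowup blowup_par1_def blowup_par2_def)
    then show "open (blowup_par1 -` (points blowup_C2 \<inter> fst -` W))"
      "open (blowup_par2 -` (points blowup_C2 \<inter> fst -` W))"
      by (simp_all, (intro open_vimage assms continuous_on_vector2 continuous_intros)+)
  qed
  then show ?thesis
    unfolding openin_charts[OF charts_ok_blowup]
    by (auto simp: blowup_C2_def[abs_def] inv_image_range inj_blowup_par)
qed

text \<open>
  \<^const>\<open>blowup_par1\<close> followed by the automorphism of the blow-up induced by \<open>A\<close>. With \<open>A\<close> the
  derivative of a map into the plane, this reduces questions about the map to the case in which its
  derivative is the identity.
\<close>

definition blowup_par :: "complex^2^2 \<Rightarrow> complex^2 \<Rightarrow> (complex^2) \<times> (complex^2) set" where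
  "blowup_par A w = (A *v vector [w $ 1, w $ 1 * w $ 2], cline (A *v vector [1, w $ 2]))"

text \<open>The vector \<open>A (1, t)\<close> has components \<open>v 1\<close>,
  \<open>v 2\<close>, which do not vanish together. Where \<open>v i\<close> is nonzero the i-th
  chart applies, and the Jacobian determinant there is \<open>det A / v i\<close>.\<close>

lemma regular_at_blowup_par:
  assumes A: "det A \<noteq> 0"
  shows "regular_at blowup_C2 (blowup_par A) w"
proof -
  define v where "v i w = A $ i $ 1 + A $ i $ 2 * w $ 2" for i and w :: "complex^2"
  have par: "blowup_par A w = (w $ 1 *s vector [v 1 w, v 2 w], cline (vector [v 1 w, v 2 w]))" for w
    by (simp add: blowup_par_def v_def)
      (intro conjI arg_cong[where f = cline]; simp add: vec_eq_iff forall_2 mat2_vec_nth algebra_simps)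
  have v': "has_partials (v i) w 0 (A $ i $ 2)" for i w
    unfolding v_def
    using has_partials_add[OF has_partials_const has_partials_mult[OF has_partials_const has_partials_nth(2)]]
    by simp
  have xv': "has_partials (\<lambda>w. w $ 1 * v i w) w (v i w) (w $ 1 * A $ i $ 2)" for i w
    using has_partials_mult[OF has_partials_nth(1) v'] by simp
  \<comment> \<open>Used twice: it excludes a common zero of \<open>v 1\<close> and
    \<open>v 2\<close>, and it is the numerator of the Jacobian determinant in both charts, up to
    sign.\<close>
  have det: "v 1 w * A $ 2 $ 2 - v 2 w * A $ 1 $ 2 = det A" for w
    by (simp add: v_def det_2 algebra_simps)
  have op: "open {w. v i w \<noteq> 0}" for i
    using has_partials_continuous[OF v'] by (intro open_Collect_neq continuous_at_imp_continuous_on) auto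
  have "v 1 w \<noteq> 0 \<or> v 2 w \<noteq> 0" using det[of w] A by auto
  then show ?thesis
  proof
    assume v1: "v 1 w \<noteq> 0"
    define q :: "complex^2 \<Rightarrow> complex^2" where "q = (\<lambda>w. vector [w $ 1 * v 1 w, v 2 w / v 1 w])"
    have eq: "blowup_par A w = blowup_par1 (q w)" if "v 1 w \<noteq> 0" for w
      using cline_vector2(1)[OF that, of "v 2 w"] that
      by (simp add: par blowup_par1_def q_def vec_eq_iff forall_2)
    have invq: "inv blowup_par1 (blowup_par A w) = q w" if "v 1 w \<noteq> 0" for w
      by (simp add: eq[OF that] inj_blowup_par)
    have q: "q holomorphic2_on {w. v 1 w \<noteq> 0}"
      unfolding q_def
      by (rule holomorphic2_on_vector2[OF op]) (use xv' has_partials_divide[OF v' v'] in blast)+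
    have q': "(q has_derivative (\<lambda>h. (vector [vector [v 1 w, w $ 1 * A $ 1 $ 2],
        vector [0, (A $ 2 $ 2 * v 1 w - v 2 w * A $ 1 $ 2) / (v 1 w)^2]] :: complex^2^2) *v h)) (at w)"
      unfolding q_def using has_derivative_vector2[OF xv' has_partials_divide[OF v' v' v1]] by simp
    show ?thesis
    proof (rule regular_atI[OF _ op])
      show "(range blowup_par1, inv blowup_par1) \<in> blowup_C2" by (simp add: blowup_C2_def)
      show "blowup_par A ` {w. v 1 w \<noteq> 0} \<subseteq> range blowup_par1" using eq by auto
      show "(inv blowup_par1 \<circ> blowup_par A) holomorphic2_on {w. v 1 w \<noteq> 0}"
        by (rule holomorphic2_on_cong[OF q]) (simp add: invq)
      show "(inv blowup_par1 \<circ> blowup_par A has_derivative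
        (\<lambda>h. (vector [vector [v 1 w, w $ 1 * A $ 1 $ 2],
        vector [0, (A $ 2 $ 2 * v 1 w - v 2 w * A $ 1 $ 2) / (v 1 w)^2]] :: complex^2^2) *v h)) (at w)"
        by (rule has_derivative_transform_within_open[OF q' op]) (use v1 invq in auto)
    qed (use v1 det[of w] A in \<open>auto simp: det_vector2 algebra_simps\<close>)
  next
    assume v2: "v 2 w \<noteq> 0"
    define q :: "complex^2 \<Rightarrow> complex^2" where "q = (\<lambda>w. vector [v 1 w / v 2 w, w $ 1 * v 2 w])"
    have eq: "blowup_par A w = blowup_par2 (q w)" if "v 2 w \<noteq> 0" for w
      using cline_vector2(2)[OF that, of "v 1 w"] that
      by (simp add: par blowup_par2_def q_def vec_eq_iff forall_2)
    have invq: "inv blowup_par2 (blowup_par A w) = q w" if "v 2 w \<noteq> 0" for w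
      by (simp add: eq[OF that] inj_blowup_par)
    have q: "q holomorphic2_on {w. v 2 w \<noteq> 0}"
      unfolding q_def
      by (rule holomorphic2_on_vector2[OF op]) (use xv' has_partials_divide[OF v' v'] in blast)+
    have q': "(q has_derivative (\<lambda>h. (vector [
        vector [0, (A $ 1 $ 2 * v 2 w - v 1 w * A $ 2 $ 2) / (v 2 w)^2],
        vector [v 2 w, w $ 1 * A $ 2 $ 2]] :: complex^2^2) *v h)) (at w)"
      unfolding q_def using has_derivative_vector2[OF has_partials_divide[OF v' v' v2] xv'] by simp
    show ?thesis
    proof (rule regular_atI[OF _ op])
      show "(range blowup_par2, inv blowup_par2) \<in> blowup_C2" by (simp add: blowup_C2_def)
      show "blowup_par A ` {w. v 2 w \<noteq> 0} \<subseteq> range blowup_par2" using eq by auto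
      show "(inv blowup_par2 \<circ> blowup_par A) holomorphic2_on {w. v 2 w \<noteq> 0}"
        by (rule holomorphic2_on_cong[OF q]) (simp add: invq)
      show "(inv blowup_par2 \<circ> blowup_par A has_derivative
        (\<lambda>h. (vector [
        vector [0, (A $ 1 $ 2 * v 2 w - v 1 w * A $ 2 $ 2) / (v 2 w)^2],
        vector [v 2 w, w $ 1 * A $ 2 $ 2]] :: complex^2^2) *v h)) (at w)"
        by (rule has_derivative_transform_within_open[OF q' op]) (use v2 invq in auto)
    qed (use v2 det[of w] A in \<open>auto simp: det_vector2 algebra_simps\<close>)
  qed
qed

text \<open>Multiplication by it exchanges the columns of \<open>A\<close>, so
  \<open>blowup_par (A ** swap2)\<close> is centred at the direction \<open>A (0, 1)\<close>, the
  only one that \<open>blowup_par A\<close> misses over the origin.\<close>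

definition swap2 :: "complex^2^2" where
  "swap2 = vector [vector [0, 1], vector [1, 0]]"

lemma swap2_mult: "swap2 *v w = vector [w $ 2, w $ 1]"
  by (simp add: vec_eq_iff forall_2 mat2_vec_nth swap2_def)

lemma det_swap2: "det (A ** swap2) \<noteq> 0 \<longleftrightarrow> det A \<noteq> 0"
  by (simp add: det_mul swap2_def det_vector2)

text \<open>Write a spanning vector of the line as \<open>A u\<close>. If \<open>u $ 1\<close> is
  nonzero the slope is \<open>u $ 2 / u $ 1\<close>; otherwise the line is spanned by
  \<open>A (0, 1)\<close>, which in the application is the tangent of the old curve.\<close>

lemma blowup_fibre_cases:
  assumes b: "b \<in> points blowup_C2" "fst b = 0" and A: "det A \<noteq> 0"
  shows "(\<exists>t. b = blowup_par A (vector [0, t])) \<or> b = blowup_par (A ** swap2) 0"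
proof -
  obtain v where v: "v \<noteq> 0" "b = (0, cline v)"
  proof -
    from b(1) consider w where "b = blowup_par1 w" | w where "b = blowup_par2 w"
      by (auto simp: points_blowup)
    then show thesis
    proof cases
      case 1
      then show ?thesis
        using b(2) that[of "vector [1, w $ 2]"] by (auto simp: blowup_par1_def vec_eq_iff forall_2)
    next
      case 2
      then show ?thesis
        using b(2) that[of "vector [w $ 1, 1]"] by (auto simp: blowup_par2_def vec_eq_iff forall_2)
    qed
  qed
  obtain B where B: "A ** B = mat 1"
    using A by (metis invertible_det_nz invertible_def)
  define u where "u = B *v v"
  have Au: "A *v u = v" by (simp add: u_def matrix_vector_mul_assoc B)
  have zero: "vector [0, 0 * t] = (0 :: complex^2)" for t
    by (simp add: vec_eq_iff forall_2)
  show ?thesis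
  proof (cases "u $ 1 = 0")
    case False
    then have "u = u $ 1 *s vector [1, u $ 2 / u $ 1]" by (simp add: vec_eq_iff forall_2)
    then have "v = u $ 1 *s (A *v vector [1, u $ 2 / u $ 1])"
      using Au by (metis vector_scalar_commute)
    then have "cline v = cline (A *v vector [1, u $ 2 / u $ 1])"
      using cline_scale[OF False] by metis
    then have "b = blowup_par A (vector [0, u $ 2 / u $ 1])"
      using zero by (simp add: v(2) blowup_par_def)
    then show ?thesis by blast
  next
    case True
    have u2: "u $ 2 \<noteq> 0"
    proof
      assume "u $ 2 = 0"
      then have "u = 0" using True by (simp add: vec_eq_iff forall_2)
      then show False using Au v(1) by (simp add: matrix_vector_mult_0_right)
    qed
    have "u = u $ 2 *s (swap2 *v vector [1, 0])"
      unfolding swap2_mult using True by (simp add: vec_eq_iff forall_2)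
    then have "v = u $ 2 *s ((A ** swap2) *v vector [1, 0])"
      using Au by (metis vector_scalar_commute matrix_vector_mul_assoc)
    then have "cline v = cline ((A ** swap2) *v vector [1, 0])"
      using cline_scale[OF u2] by metis
    then show ?thesis
      using zero[of 0] by (simp add: v(2) blowup_par_def)
  qed
qed

section \<open>Lifting to a blow-up\<close>

text \<open>Only the first coordinate is confined to \<open>B\<close>; the second ranges over the
  whole plane of complex numbers. Regularity is kept apart because \<open>adapted_blowup\<close>
  takes it at one preimage of the centre and returns it along the whole line.\<close>

definition adapted :: "complex set \<Rightarrow> 'a atlas \<Rightarrow> 'a set \<Rightarrow> (complex^2 \<Rightarrow> 'a) \<Rightarrow> bool" where
  "adapted B V E F \<longleftrightarrow> complex_surface V \<and> closedin (surface_topology V) E \<and>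
     (\<forall>z. z $ 1 \<in> B \<longrightarrow> holomorphic_at V F z \<and> (F z \<in> E \<longleftrightarrow> z $ 1 = 0))"

text \<open>The curve \<open>\<psi> (0, y)\<close> is tangent to \<open>A (0, 1)\<close> at
  \<open>y = s0\<close>. In the swapped chart its lift is \<open>(e2, e1 / e2)\<close> and tends to
  the origin, so other points of the curve lift arbitrarily close to the missing direction. This
  will place that direction in the proper transform.\<close>

lemma line_slice_in_swapped_chart:
  fixes W :: "(complex^2) set"
  assumes \<psi>: "\<psi> holomorphic2_on N" and s0: "vector [0, s0] \<in> N" "\<psi> (vector [0, s0]) = 0"
    and A: "(\<psi> has_derivative (\<lambda>h. A *v h)) (at (vector [0, s0]))" "det A \<noteq> 0"
    and W: "open W" "0 \<in> W"
  obtains y and w :: "complex^2" where "y \<noteq> s0" "vector [0, y] \<in> N" "w \<in> W"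
    "(A ** swap2) *v vector [w $ 1, w $ 1 * w $ 2] = \<psi> (vector [0, y])" "\<psi> (vector [0, y]) \<noteq> 0"
proof -
  obtain B where B: "A ** B = mat 1" "B ** A = mat 1"
    using A(2) by (metis invertible_det_nz invertible_def)
  define H where "H = (\<lambda>w. B *v w) \<circ> \<psi>"
  have AH: "A *v H w = \<psi> w" for w by (simp add: H_def matrix_vector_mul_assoc B)
  have "((\<lambda>w. B *v w) has_derivative (\<lambda>h. B *v h)) (at (\<psi> (vector [0, s0])))"
    by (intro bounded_linear_imp_has_derivative matrix_vector_mul_bounded_linear)
  from has_derivative_mat_compose[OF A(1) this]
  have "(H has_derivative (\<lambda>h. mat 1 *v h)) (at (vector [0, s0]))"
    by (simp add: H_def B)
  then have "has_partials (\<lambda>w. H w $ 1) (vector [0, s0]) 1 0" "has_partials (\<lambda>w. H w $ 2) (vector [0, s0]) 0 1"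
    unfolding has_derivative_vec2_iff by (simp_all add: mat_def)
  note H' = this[THEN has_partials_imp_slices(2), simplified]
  define e1 where "e1 = (\<lambda>y. H (vector [0, y]) $ 1)"
  define e2 where "e2 = (\<lambda>y. H (vector [0, y]) $ 2)"
  have "H (vector [0, s0]) = 0" using s0 by (simp add: H_def)
  then have e0: "e1 s0 = 0" "e2 s0 = 0" by (simp_all add: e1_def e2_def)
  have e': "(e1 has_field_derivative 0) (at s0)" "(e2 has_field_derivative 1) (at s0)"
    using H' by (simp_all add: e1_def e2_def)
  have quot: "((\<lambda>y. e1 y / (y - s0)) \<longlongrightarrow> 0) (at s0)" "((\<lambda>y. e2 y / (y - s0)) \<longlongrightarrow> 1) (at s0)"
    using e' by (simp_all add: has_field_derivative_iff e0)
  have "((\<lambda>y. (e1 y / (y - s0)) / (e2 y / (y - s0))) \<longlongrightarrow> 0 / 1) (at s0)"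
    by (intro tendsto_divide quot) simp
  \<comment> \<open>Cancelling \<open>y - s0\<close> is valid even where \<open>e2 y = 0\<close>,
    since both sides are then 0 by the convention for division by zero.\<close>
  then have lim1: "((\<lambda>y. e1 y / e2 y) \<longlongrightarrow> 0) (at s0)"
    unfolding div_0 by (rule Lim_transform_eventually) (auto simp: eventually_at_filter)
  have lim2: "(e2 \<longlongrightarrow> 0) (at s0)"
    using DERIV_isCont[OF e'(2)] e0 by (simp add: isCont_def)
  define w where "w = (\<lambda>y. vector [e2 y, e1 y / e2 y] :: complex^2)"
  have "(w \<longlongrightarrow> 0) (at s0)"
  proof (rule vec_tendstoI)
    fix i :: 2
    consider "i = 1" | "i = 2" using exhaust_2 by blast
    then show "((\<lambda>y. w y $ i) \<longlongrightarrow> 0 $ i) (at s0)"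
      by cases (use lim1 lim2 in \<open>simp_all add: w_def\<close>)
  qed
  then have ev1: "eventually (\<lambda>y. w y \<in> W) (at s0)"
    using W by (rule topological_tendstoD)
  \<comment> \<open>As division by zero gives 0, a nonzero quotient encodes both
    \<open>y \<noteq> s0\<close> and \<open>e2 y \<noteq> 0\<close>.\<close>
  have ev2: "eventually (\<lambda>y. e2 y / (y - s0) \<noteq> 0) (at s0)"
    using quot(2) by (rule tendsto_imp_eventually_ne) simp
  have "open ((\<lambda>y. vector [0, y]) -` N)"
    by (intro open_vimage holomorphic2_on_open[OF \<psi>] continuous_on_vector2 continuous_intros)
  then have ev3: "eventually (\<lambda>y. vector [0, y] \<in> N) (at s0)"
    using s0(1) by (force simp: eventually_at_topological)
  have "eventually (\<lambda>y. w y \<in> W \<and> e2 y / (y - s0) \<noteq> 0 \<and> vector [0, y] \<in> N) (at s0)"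
    using ev1 ev2 ev3 by eventually_elim blast
  then obtain y where y: "w y \<in> W" "e2 y / (y - s0) \<noteq> 0" "vector [0, y] \<in> N"
    using eventually_happens[of _ "at s0"] by (auto simp: trivial_limit_at)
  then have ne: "y \<noteq> s0" "e2 y \<noteq> 0" by auto
  have "(A ** swap2) *v vector [w y $ 1, w y $ 1 * w y $ 2] = A *v vector [e1 y, e2 y]"
    using ne by (simp add: matrix_vector_mul_assoc[symmetric] swap2_mult w_def)
  also have "\<dots> = \<psi> (vector [0, y])" using AH[of "vector [0, y]"] by (simp add: e1_def e2_def)
  finally have "(A ** swap2) *v vector [w y $ 1, w y $ 1 * w y $ 2] = \<psi> (vector [0, y])" .
  moreover have "\<psi> (vector [0, y]) \<noteq> 0"
  proof
    assume "\<psi> (vector [0, y]) = 0"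
    then have "H (vector [0, y]) = 0" by (simp add: H_def)
    then show False using ne by (simp add: e2_def)
  qed
  ultimately show ?thesis using that[of y "w y"] ne y by blast
qed

text \<open>The lift is computed near the line \<open>x = 0\<close> through the local model of the
  blow-up and elsewhere through the inverse of \<open>\<pi>\<close>. Openness of the lift keeps it
  off \<open>T\<close>, and the local model shows that \<open>T\<close> contains the one exceptional
  point not reached.\<close>

lemma adapted_blowup:
  assumes B: "open B" "0 \<in> B" and F: "adapted B V E F"
    and reg: "regular_at V F (vector [0, s0])" and p: "F (vector [0, s0]) = p"
    and blow: "is_blowup V' \<pi> V p" and T: "T = proper_transform V' \<pi> p E"
  obtains F' where
    "adapted B (restrict_surface V' (- T)) (exceptional_curve V' \<pi> p - T) F'"
    "\<And>s. regular_at (restrict_surface V' (- T)) F' (vector [0, s])"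
    "exceptional_curve V' \<pi> p - T \<subseteq> (\<lambda>s. F' (vector [0, s])) ` UNIV"
proof -
  let ?z0 = "vector [0, s0] :: complex^2"
  have V: "complex_surface V" and E: "closedin (surface_topology V) E"
    and Fhol: "\<And>z. z $ 1 \<in> B \<Longrightarrow> holomorphic_at V F z"
    and FE: "\<And>z. z $ 1 \<in> B \<Longrightarrow> F z \<in> E \<longleftrightarrow> z $ 1 = 0"
    using F by (auto simp: adapted_def)
  have pE: "p \<in> E" using FE[of ?z0] B(2) p by simp
  have V': "complex_surface V'" and pV: "p \<in> points V" and \<pi>: "holomorphic_map V' V \<pi>"
    and \<pi>_bihol: "biholomorphic_map (restrict_surface V' (- (\<pi> -` {p}))) (restrict_surface V (- {p})) \<pi>"
    using blow by (auto simp: is_blowup_def)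
  obtain U \<phi> \<Phi> where U: "openin (surface_topology V) U" "p \<in> U" and \<phi>U: "open (\<phi> ` U)" "\<phi> p = 0"
    and \<phi>: "biholomorphic_map (restrict_surface V U) (restrict_surface C2 (\<phi> ` U)) \<phi>"
    and \<Phi>: "biholomorphic_map (restrict_surface V' (\<pi> -` U))
          (restrict_surface blowup_C2 (fst -` (\<phi> ` U))) \<Phi>"
    and \<Phi>\<phi>: "\<And>y. y \<in> points V' \<Longrightarrow> \<pi> y \<in> U \<Longrightarrow> fst (\<Phi> y) = \<phi> (\<pi> y)"
    using blow unfolding is_blowup_def by blast
  note ok = complex_surface_charts_ok[OF V] and ok' = complex_surface_charts_ok[OF V']
  note top = topspace_charts[OF ok] and top' = topspace_charts[OF ok']
  have \<pi>c: "continuous_map (surface_topology V') (surface_topology V) \<pi>"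
    using \<pi> by (simp add: holomorphic_map_def)
  have \<pi>pre: "openin (surface_topology V') (points V' \<inter> \<pi> -` S)" if "openin (surface_topology V) S" for S
    using openin_continuous_map_preimage[OF \<pi>c that] by (simp add: top' vimage_def Int_def)
  have \<pi>prec: "closedin (surface_topology V') (points V' \<inter> \<pi> -` S)" if "closedin (surface_topology V) S" for S
    using closedin_continuous_map_preimage[OF \<pi>c that] by (simp add: top' vimage_def Int_def)
  have clp: "closedin (surface_topology V) {p}"
    using V pV by (auto simp: complex_surface_def top intro: closedin_Hausdorff_singleton)
  have Vp: "openin (surface_topology V) (points V \<inter> - {p})"
    using openin_diff[OF openin_topspace clp] by (simp add: top Diff_eq)
  have "\<pi> y \<in> points V" if "y \<in> points V'" for y
    using \<pi>c that unfolding continuous_map_def by (auto simp: top top')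
  then have "points V' \<inter> \<pi> -` (points V \<inter> - {p}) = points V' \<inter> - (\<pi> -` {p})" by auto
  then have V'p: "openin (surface_topology V') (points V' \<inter> - (\<pi> -` {p}))"
    using \<pi>pre[OF Vp] by simp
  have Usub: "points V \<inter> U = U" using openin_subset[OF U(1)] top by auto
  have VU: "openin (surface_topology V) (points V \<inter> U)" using U(1) Usub by simp
  note V'U = \<pi>pre[OF U(1)]
  note ok1 = charts_ok_restrict[OF ok Vp] and ok1' = charts_ok_restrict[OF ok' V'p]
    and okU = charts_ok_restrict[OF ok VU] and okU' = charts_ok_restrict[OF ok' V'U]
    and okb = charts_ok_restrict[OF charts_ok_blowup openin_blowup_fst[OF \<phi>U(1)]]
  have okC: "charts_ok (restrict_surface C2 (\<phi> ` U))"
    by (rule charts_ok_restrict[OF charts_ok_C2]) (use \<phi>U(1) in \<open>simp add: openin_C2 points_C2\<close>)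

  obtain g0 where g0: "holomorphic_map (restrict_surface V (- {p})) (restrict_surface V' (- (\<pi> -` {p}))) g0"
    and g0\<pi>: "\<And>y. y \<in> points V' \<Longrightarrow> \<pi> y \<noteq> p \<Longrightarrow> g0 (\<pi> y) = y"
    and \<pi>g0: "\<And>x. x \<in> points V \<Longrightarrow> x \<noteq> p \<Longrightarrow> \<pi> (g0 x) = x"
    using \<pi>_bihol by (auto simp: biholomorphic_map_def)
  obtain g where gh: "holomorphic_map (restrict_surface blowup_C2 (fst -` (\<phi> ` U))) (restrict_surface V' (\<pi> -` U)) g"
    and g\<Phi>: "\<And>y. y \<in> points V' \<Longrightarrow> \<pi> y \<in> U \<Longrightarrow> g (\<Phi> y) = y"
    and \<Phi>g: "\<And>b. b \<in> points blowup_C2 \<Longrightarrow> fst b \<in> \<phi> ` U \<Longrightarrow> \<Phi> (g b) = b"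
    using \<Phi> by (auto simp: biholomorphic_map_def)
  have gb: "biholomorphic_map (restrict_surface blowup_C2 (fst -` (\<phi> ` U))) (restrict_surface V' (\<pi> -` U)) g"
    using \<Phi> gh g\<Phi> \<Phi>g unfolding biholomorphic_map_def by auto
  have gpt: "g b \<in> points V'" "\<pi> (g b) \<in> U" if "b \<in> points blowup_C2" "fst b \<in> \<phi> ` U" for b
    using gh that unfolding holomorphic_map_def continuous_map_def
    by (auto simp: topspace_charts[OF okb] topspace_charts[OF okU'])
  have \<Phi>pt: "\<Phi> y \<in> points blowup_C2" if "y \<in> points V'" "\<pi> y \<in> U" for y
    using \<Phi> that unfolding biholomorphic_map_def holomorphic_map_def continuous_map_def
    by (auto simp: topspace_charts[OF okb] topspace_charts[OF okU'])
  have \<phi>inj: "inj_on \<phi> U"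
    using \<phi> Usub by (auto simp: biholomorphic_map_def intro: inj_on_inverseI)
  have \<pi>g: "\<pi> (g b) = x" if "b \<in> points blowup_C2" "fst b = \<phi> x" "x \<in> U" for b x
  proof -
    have b: "fst b \<in> \<phi> ` U" using that by simp
    have "\<phi> (\<pi> (g b)) = \<phi> x" using \<Phi>\<phi>[OF gpt[OF that(1) b]] \<Phi>g[OF that(1) b] that(2) by simp
    then show ?thesis using \<phi>inj gpt(2)[OF that(1) b] that(3) by (auto dest: inj_onD)
  qed
  have parpt: "blowup_par A w \<in> points blowup_C2" if "det A \<noteq> 0" for A w
    using holomorphic_at_points regular_imp_holomorphic_at regular_at_blowup_par[OF that] by blast

  \<comment> \<open>The coordinate \<open>\<phi>\<close> comes with the blow-up and need not belong
    to the atlas, so regularity is carried through it as a biholomorphic map and read off in the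
    identity chart.\<close>
  have "regular_at (restrict_surface V U) F ?z0"
    by (rule regular_at_restrictI[OF ok reg VU]) (use p U in simp)
  from regular_at_compose[OF okU okC this \<phi>]
  have "regular_at C2 (\<phi> \<circ> F) ?z0" by (rule regular_at_restrictD)
  then obtain N1 A where N1: "open N1" "?z0 \<in> N1" "(\<phi> \<circ> F) holomorphic2_on N1"
    and A: "(\<phi> \<circ> F has_derivative (\<lambda>h. A *v h)) (at ?z0)" "det A \<noteq> 0"
    by (rule regular_atE) (auto simp: C2_def)
  obtain N2 where N2: "open N2" "?z0 \<in> N2" "F ` N2 \<subseteq> U"
    using holomorphic_at_continuous[OF ok regular_imp_holomorphic_at[OF reg] U(1)] p U(2) by blast
  have Bop: "open {z::complex^2. z $ 1 \<in> B}"
    using open_vimage[OF B(1), of "\<lambda>z::complex^2. z $ 1"] by (simp add: vimage_def continuous_intros)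
  define N where "N = N1 \<inter> N2 \<inter> {z. z $ 1 \<in> B}"
  have Nop: "open N" using N1 N2 Bop by (auto simp: N_def)
  have N: "?z0 \<in> N" "\<And>z. z \<in> N \<Longrightarrow> F z \<in> U" "\<And>z. z \<in> N \<Longrightarrow> z $ 1 \<in> B"
    using N1 N2 B by (auto simp: N_def)
  have \<psi>: "(\<phi> \<circ> F) holomorphic2_on N" by (rule holomorphic2_on_subset[OF N1(3) Nop]) (auto simp: N_def)
  have \<psi>0: "(\<phi> \<circ> F) ?z0 = 0" using p \<phi>U by simp

  define q :: "complex^2 \<Rightarrow> complex^2" where "q = (\<lambda>w. vector [w $ 1, s0 + w $ 1 * w $ 2])"
  have q1: "q w $ 1 = w $ 1" for w by (simp add: q_def)
  have q0: "q w = ?z0" if "w $ 1 = 0" for w using that by (simp add: q_def)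
  have qhol: "q holomorphic2_on UNIV"
    unfolding q_def
  proof (rule holomorphic2_on_vector2)
    show "\<exists>p r. has_partials (\<lambda>w. s0 + w $ 1 * w $ 2) w p r" for w
      using has_partials_add[OF has_partials_const has_partials_mult[OF has_partials_nth]] by blast
  qed (use has_partials_nth in blast)+
  obtain M R where M: "open M" "\<And>w. w $ 1 = 0 \<Longrightarrow> w \<in> M" "\<And>w. w \<in> M \<Longrightarrow> q w \<in> N"
    and R: "R holomorphic2_on M"
      "\<And>w. w \<in> M \<Longrightarrow> A *v vector [R w $ 1, R w $ 1 * R w $ 2] = (\<phi> \<circ> F) (q w)"
      "\<And>w. w $ 1 = 0 \<Longrightarrow> R w = w"
      "\<And>w. w $ 1 = 0 \<Longrightarrow> \<exists>J::complex^2^2. (R has_derivative (\<lambda>h. J *v h)) (at w) \<and> det J \<noteq> 0"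
    unfolding q_def by (rule blowup_lift_coordinates[OF \<psi> N(1) \<psi>0 A]) blast

  define b where "b = blowup_par A \<circ> R"
  define G where "G = g \<circ> b"
  have fstb: "fst (b w) = \<phi> (F (q w))" "F (q w) \<in> U" if "w \<in> M" for w
    using R(2)[OF that] N(2)[OF M(3)[OF that]] by (simp_all add: b_def blowup_par_def)
  have bpt: "b w \<in> points blowup_C2" for w using parpt[OF A(2)] by (simp add: b_def)
  have Ghol: "holomorphic_at V' G w" if w: "w \<in> M" for w
  proof -
    have "holomorphic_at blowup_C2 b w"
      unfolding b_def
      by (rule holomorphic_at_precompose[OF regular_imp_holomorphic_at[OF regular_at_blowup_par[OF A(2)]] R(1) w])
    then have "holomorphic_at (restrict_surface blowup_C2 (fst -` (\<phi> ` U))) b w"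
      by (rule holomorphic_at_restrictI[OF charts_ok_blowup _ openin_blowup_fst[OF \<phi>U(1)]])
        (use fstb[OF w] in simp)
    from holomorphic_at_compose[OF okb okU' this gh]
    show ?thesis unfolding G_def by (rule holomorphic_at_restrictD)
  qed
  have Greg: "regular_at V' G w" if w: "w $ 1 = 0" for w
  proof -
    obtain J :: "complex^2^2" where J: "(R has_derivative (\<lambda>h. J *v h)) (at w)" "det J \<noteq> 0"
      using R(4)[OF w] by blast
    have "regular_at blowup_C2 b w"
      unfolding b_def
      by (rule regular_at_precompose[OF regular_at_blowup_par[OF A(2)] R(1) M(2)[OF w] J])
    then have "regular_at (restrict_surface blowup_C2 (fst -` (\<phi> ` U))) b w"
      by (rule regular_at_restrictI[OF charts_ok_blowup _ openin_blowup_fst[OF \<phi>U(1)]])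
        (use fstb[OF M(2)[OF w]] in simp)
    from regular_at_compose[OF okb okU' this gb]
    show ?thesis unfolding G_def by (rule regular_at_restrictD)
  qed
  have \<pi>G: "\<pi> (G w) = F (q w)" "G w \<in> points V'" if "w \<in> M" for w
    using \<pi>g[OF bpt fstb[OF that]] holomorphic_at_points[OF Ghol[OF that]] by (simp_all add: G_def)

  \<comment> \<open>Off the line the lift is forced by the inverse of \<open>\<pi>\<close>; on it,
    \<open>blowup_par A\<close> gives the limiting direction. On the neighbourhood \<open>M\<close>
    of the line both agree with \<open>G\<close>, since \<open>R\<close> is the identity on the
    line.\<close>
  define F' where "F' = (\<lambda>w. if w $ 1 = 0 then g (blowup_par A w) else g0 (F (q w)))"
  have Fq_ne: "F (q w) \<notin> E" "F (q w) \<noteq> p" "F (q w) \<in> points V" if "w $ 1 \<in> B" "w $ 1 \<noteq> 0" for w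
    using FE[of "q w"] pE that q1 holomorphic_at_points[OF Fhol[of "q w"]] by auto
  have F'G: "F' w = G w" if w: "w \<in> M" for w
  proof (cases "w $ 1 = 0")
    case True
    then show ?thesis using R(3) by (simp add: F'_def G_def b_def)
  next
    case False
    have "w $ 1 \<in> B" using N(3)[OF M(3)[OF w]] q1 by simp
    then show ?thesis
      using Fq_ne[of w] False \<pi>G[OF w] g0\<pi>[of "G w"] by (simp add: F'_def)
  qed
  have F'hol: "holomorphic_at V' F' w" if w: "w $ 1 \<in> B" for w
  proof (cases "w $ 1 = 0")
    case True
    show ?thesis by (rule holomorphic_at_cong[OF Ghol[OF M(2)[OF True]] M(1) M(2)[OF True] F'G])
  next
    case False
    have "holomorphic_at V (F \<circ> q) w"
      by (rule holomorphic_at_precompose[OF _ qhol]) (use Fhol[of "q w"] w q1 in auto)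
    then have "holomorphic_at (restrict_surface V (- {p})) (F \<circ> q) w"
      by (rule holomorphic_at_restrictI[OF ok _ Vp]) (use Fq_ne(2)[OF w False] in simp)
    from holomorphic_at_restrictD[OF holomorphic_at_compose[OF ok1 ok1' this g0]]
    show ?thesis
    proof (rule holomorphic_at_cong)
      show "open {w::complex^2. w $ 1 \<noteq> 0}" by (intro open_Collect_neq continuous_intros)
    qed (use False in \<open>auto simp: F'_def\<close>)
  qed
  have \<pi>F': "\<pi> (F' w) = F (q w)" if w: "w $ 1 \<in> B" for w
  proof (cases "w $ 1 = 0")
    case True
    then show ?thesis using \<pi>G F'G M(2) by simp
  next
    case False
    then show ?thesis using \<pi>g0 Fq_ne[OF w False] by (simp add: F'_def)
  qed

  let ?K = "points V' \<inter> \<pi> -` (E - {p})" and ?X = "exceptional_curve V' \<pi> p"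
  have T': "T = surface_topology V' closure_of ?K" by (simp add: T proper_transform_def)
  have clT: "closedin (surface_topology V') T" by (simp add: T')
  \<comment> \<open>Closedness of \<open>E\<close> gives this inclusion, which keeps the lift away
    from \<open>T\<close> off the line, where \<open>F\<close> misses \<open>E\<close>.\<close>
  have TE: "T \<subseteq> \<pi> -` E"
    unfolding T' using closure_of_minimal[OF _ \<pi>prec[OF E], of ?K] by blast
  have Xeq: "?X = points V' \<inter> \<pi> -` {p}" by (simp add: exceptional_curve_def)
  have F'T: "F' w \<notin> T" if w: "w $ 1 \<in> B" for w
  proof (cases "w $ 1 = 0")
    case False
    then show ?thesis using TE \<pi>F'[OF w] Fq_ne(1)[OF w False] by auto
  next
    case True
    \<comment> \<open>A neighbourhood of \<open>G w\<close> consists of values of \<open>G\<close>.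
      Over \<open>E\<close> these have first parameter 0, hence lie over \<open>p\<close> itself, so
      the neighbourhood misses the set whose closure is \<open>T\<close>.\<close>
    obtain S where S: "openin (surface_topology V') S" "G w \<in> S" "S \<subseteq> G ` M"
      by (rule regular_at_open_mapping[OF V' Greg[OF True] M(1) M(2)[OF True]])
    have "S \<inter> ?K = {}"
    proof (rule ccontr)
      assume "S \<inter> ?K \<noteq> {}"
      then obtain v where v: "v \<in> M" "\<pi> (G v) \<in> E" "\<pi> (G v) \<noteq> p" using S(3) by blast
      then have "F (q v) \<in> E" "F (q v) \<noteq> p" using \<pi>G by auto
      moreover have "q v $ 1 \<in> B" using N(3)[OF M(3)[OF v(1)]] .
      ultimately have "v $ 1 = 0" using FE[of "q v"] q1 by simp
      then show False using \<open>F (q v) \<noteq> p\<close> q0 p by simp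
    qed
    then have "G w \<notin> T"
      unfolding T' in_closure_of using S by blast
    then show ?thesis using F'G[OF M(2)[OF True]] by simp
  qed

  have exc: "y \<in> range (\<lambda>s. F' (vector [0, s]))" if y: "y \<in> ?X - T" for y
  proof -
    have yp: "y \<in> points V'" "\<pi> y = p" "y \<notin> T" using y by (auto simp: Xeq)
    then have yU: "\<pi> y \<in> U" using U by simp
    have "fst (\<Phi> y) = 0" using \<Phi>\<phi>[OF yp(1) yU] yp(2) \<phi>U(2) by simp
    then consider t where "\<Phi> y = blowup_par A (vector [0, t])" | "\<Phi> y = blowup_par (A ** swap2) 0"
      using blowup_fibre_cases[OF \<Phi>pt[OF yp(1) yU] _ A(2)] by blast
    then show ?thesis
    proof cases
      case 1
      then have "y = F' (vector [0, t])" using g\<Phi>[OF yp(1) yU] by (simp add: F'_def)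
      then show ?thesis by blast
    next
      case 2
      let ?A' = "A ** swap2"
      have A': "det ?A' \<noteq> 0" using A(2) by (simp add: det_swap2)
      have f0: "fst (blowup_par ?A' 0) \<in> \<phi> ` U"
        using 2 \<Phi>\<phi>[OF yp(1) yU] yU by (metis imageI)
      have "holomorphic_at (restrict_surface blowup_C2 (fst -` (\<phi> ` U))) (blowup_par ?A') 0"
        by (rule holomorphic_at_restrictI[OF charts_ok_blowup
              regular_imp_holomorphic_at[OF regular_at_blowup_par[OF A']] openin_blowup_fst[OF \<phi>U(1)]])
          (use f0 in simp)
      from holomorphic_at_restrictD[OF holomorphic_at_compose[OF okb okU' this gh]]
      have hol: "holomorphic_at V' (g \<circ> blowup_par ?A') 0" .
      \<comment> \<open>The remaining exceptional point is the tangent direction of the curve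
        \<open>F (0, s)\<close>. Every neighbourhood of it contains lifts of points of that curve
        other than \<open>p\<close>, and these points lie in \<open>E\<close>.\<close>
      have "y \<in> T"
        unfolding T' in_closure_of
      proof (intro conjI allI impI)
        show "y \<in> topspace (surface_topology V')" using yp top' by simp
        fix S assume S: "y \<in> S \<and> openin (surface_topology V') S"
        have "(g \<circ> blowup_par ?A') 0 \<in> S" using S 2 g\<Phi>[OF yp(1) yU] by simp
        then obtain W where W: "open W" "0 \<in> W" "(g \<circ> blowup_par ?A') ` W \<subseteq> S"
          using holomorphic_at_continuous[OF ok' hol] S by blast
        obtain s w where s: "s \<noteq> s0" "vector [0, s] \<in> N" "w \<in> W"
          "?A' *v vector [w $ 1, w $ 1 * w $ 2] = (\<phi> \<circ> F) (vector [0, s])"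
          "(\<phi> \<circ> F) (vector [0, s]) \<noteq> 0"
          by (rule line_slice_in_swapped_chart[OF \<psi> N(1) \<psi>0 A W(1,2)])
        have x: "F (vector [0, s]) \<in> U" "F (vector [0, s]) \<in> E" "F (vector [0, s]) \<noteq> p"
          using N(2)[OF s(2)] FE[of "vector [0, s]"] B s(5) \<phi>U(2) by auto
        have b': "fst (blowup_par ?A' w) = \<phi> (F (vector [0, s]))" using s(4) by (simp add: blowup_par_def)
        have "\<pi> (g (blowup_par ?A' w)) = F (vector [0, s])" by (rule \<pi>g[OF parpt[OF A'] b' x(1)])
        moreover have "g (blowup_par ?A' w) \<in> points V'"
          by (rule gpt(1)[OF parpt[OF A']]) (use b' x in simp)
        ultimately show "\<exists>y. y \<in> ?K \<and> y \<in> S"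
          using x W(3) s(3) by (intro exI[of _ "g (blowup_par ?A' w)"]) auto
      qed
      then show ?thesis using yp by blast
    qed
  qed

  have V'T: "openin (surface_topology V') (points V' \<inter> - T)"
    using openin_diff[OF openin_topspace clT] by (simp add: top' Diff_eq)
  show ?thesis
  proof (rule that)
    show "adapted B (restrict_surface V' (- T)) (?X - T) F'"
      unfolding adapted_def
    proof (intro conjI allI impI)
      show "complex_surface (restrict_surface V' (- T))" by (rule complex_surface_restrict[OF V' V'T])
      show "closedin (surface_topology (restrict_surface V' (- T))) (?X - T)"
        unfolding surface_topology_restrict[OF ok' V'T] closedin_subtopology
        using \<pi>prec[OF clp] by (auto simp: Xeq)
      fix w :: "complex^2" assume w: "w $ 1 \<in> B"
      show "holomorphic_at (restrict_surface V' (- T)) F' w"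
        by (rule holomorphic_at_restrictI[OF ok' F'hol[OF w] V'T]) (use F'T[OF w] in simp)
      show "F' w \<in> ?X - T \<longleftrightarrow> w $ 1 = 0"
        using F'T[OF w] holomorphic_at_points[OF F'hol[OF w]] \<pi>F'[OF w] Fq_ne(2)[OF w] q0 p
        by (auto simp: Xeq)
    qed
    show "regular_at (restrict_surface V' (- T)) F' (vector [0, s])" for s
    proof (rule regular_at_restrictI[OF ok' _ V'T])
      show "regular_at V' F' (vector [0, s])"
        by (rule regular_at_cong[OF Greg M(1) M(2) F'G]) auto
      show "F' (vector [0, s]) \<in> - T" using F'T B(2) by simp
    qed
    show "?X - T \<subseteq> (\<lambda>s. F' (vector [0, s])) ` UNIV" using exc by blast
  qed
qed

section \<open>The family of curves transversal to the cusp\<close>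

text \<open>The exponentials are the action \<open>(t^2 u, t^3 v)\<close> with
  \<open>t = exp s\<close>, which preserves the cusp; the orbit of \<open>(1, 1)\<close> is the cusp
  without its singular point. In \<open>y = x + 2\<close> the polynomials are
  \<open>a = y^2 - 3\<close> and \<open>b = -(y^3 - 9/2 y)\<close>, where \<open>y^3 - 9/2 y\<close>
  is the polynomial part at infinity of the square root of \<open>a^3\<close>. Hence
  \<open>a^3 - b^2\<close> drops to \<open>27/4 (y^2 - 4)\<close>, and the zero
  \<open>y = 2\<close>, where \<open>a = b = 1\<close>, is moved to \<open>x = 0\<close>.\<close>

definition cusp_family :: "complex^2 \<Rightarrow> complex^2" where
  "cusp_family z = vector
     [((z $ 1)^2 + 4 * z $ 1 + 1) * exp (2 * z $ 2),
      (1 - 15 / 2 * z $ 1 - 6 * (z $ 1)^2 - (z $ 1)^3) * exp (3 * z $ 2)]"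

text \<open>Weighted homogeneity: the action multiplies \<open>u^3 - v^2\<close> by
  \<open>exp (6 s)\<close>, which has no zeros, so only the polynomial in \<open>x\<close>
  decides.\<close>

lemma cusp_family_in_L0: "cusp_family z \<in> L0 \<longleftrightarrow> z $ 1 = 0 \<or> z $ 1 = -4"
proof -
  let ?x = "z $ 1"
  have e: "exp (2 * z $ 2) ^ 3 = exp (6 * z $ 2)" "exp (3 * z $ 2) ^ 2 = exp (6 * z $ 2)"
    by (simp_all flip: exp_of_nat_mult)
  have "(cusp_family z $ 1)^3 - (cusp_family z $ 2)^2 =
      ((?x^2 + 4 * ?x + 1)^3 - (1 - 15 / 2 * ?x - 6 * ?x^2 - ?x^3)^2) * exp (6 * z $ 2)"
    unfolding cusp_family_def vector_2 power_mult_distrib e by (simp only: left_diff_distrib)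
  also have "(?x^2 + 4 * ?x + 1)^3 - (1 - 15 / 2 * ?x - 6 * ?x^2 - ?x^3)^2 = 27 / 4 * (?x * (?x + 4))"
    by (simp add: field_simps power2_eq_square power3_eq_cube)
  finally show ?thesis by (auto simp: L0_def eq_neg_iff_add_eq_0)
qed

text \<open>At the origin the determinant is \<open>3 a' - 2 b' = 12 + 15 = 27\<close>. This is the
  derivative of \<open>a^3 - b^2\<close> at 0, so it is nonzero because that zero is simple.\<close>

lemma cusp_family_derivative:
  obtains J :: "complex^2^2" where "(cusp_family has_derivative (\<lambda>h. J *v h)) (at z)"
    "z = 0 \<Longrightarrow> det J \<noteq> 0"
proof
  have ex: "has_partials (\<lambda>z. exp (c * z $ 2)) z 0 (exp (c * z $ 2) * c)" for c
    using has_partials_compose[OF DERIV_exp has_partials_mult[OF has_partials_const has_partials_nth(2)], of c z]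
    by simp
  have "((\<lambda>x. x^2 + 4 * x + 1) has_field_derivative 2 * z $ 1 + 4) (at (z $ 1))"
    by (auto intro!: derivative_eq_intros)
  from has_partials_compose[OF this has_partials_nth(1)]
  have a: "has_partials (\<lambda>z. (z $ 1)^2 + 4 * z $ 1 + 1) z (2 * z $ 1 + 4) 0"
    unfolding mult_1_right mult_zero_right .
  have "((\<lambda>x. 1 - 15 / 2 * x - 6 * x^2 - x^3) has_field_derivative
      - 15 / 2 - 12 * z $ 1 - 3 * (z $ 1)^2) (at (z $ 1))"
    by (auto intro!: derivative_eq_intros)
  from has_partials_compose[OF this has_partials_nth(1)]
  have b: "has_partials (\<lambda>z. 1 - 15 / 2 * z $ 1 - 6 * (z $ 1)^2 - (z $ 1)^3) z
      (- 15 / 2 - 12 * z $ 1 - 3 * (z $ 1)^2) 0"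
    unfolding mult_1_right mult_zero_right .
  show "(cusp_family has_derivative (\<lambda>h. (vector [
      vector [(2 * z $ 1 + 4) * exp (2 * z $ 2), ((z $ 1)^2 + 4 * z $ 1 + 1) * (exp (2 * z $ 2) * 2)],
      vector [(- 15 / 2 - 12 * z $ 1 - 3 * (z $ 1)^2) * exp (3 * z $ 2),
        (1 - 15 / 2 * z $ 1 - 6 * (z $ 1)^2 - (z $ 1)^3) * (exp (3 * z $ 2) * 3)]] :: complex^2^2) *v h)) (at z)"
    unfolding cusp_family_def[abs_def]
    using has_derivative_vector2[OF has_partials_mult[OF a ex] has_partials_mult[OF b ex]] by simp
qed (simp add: det_vector2)

text \<open>Covering of \<open>E\<close> by the line belongs to the invariant because the next
  centre is any point of \<open>E\<close>. At the start the cusp plays the part of \<open>E\<close>;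
  it is not covered entirely, but the only centre needed is \<open>(1, 1)\<close>, the value at the
  origin.\<close>

lemma V_construction_adapted:
  assumes "V_construction m V E"
  shows "\<exists>F. adapted (- {-4}) V E F \<and> (\<forall>s. regular_at V F (vector [0, s])) \<and>
    E \<subseteq> range (\<lambda>s. F (vector [0, s]))"
  using assms
proof induction
  case (V_first V' \<pi> T)
  have hol: "cusp_family holomorphic2_on UNIV"
    unfolding holomorphic2_on_def using cusp_family_derivative by (metis open_UNIV)
  have L0: "closedin (surface_topology C2) L0"
    unfolding closedin_def topspace_C2 openin_C2 Compl_eq_Diff_UNIV[symmetric] open_closed double_complement
    unfolding L0_def by (auto intro!: closed_Collect_eq continuous_intros)
  have F: "adapted (- {-4}) C2 L0 cusp_family"
    using V_first(1) L0 hol by (auto simp: adapted_def is_blowup_def holomorphic_at_C2 cusp_family_in_L0)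
  obtain J :: "complex^2^2" where "(cusp_family has_derivative (\<lambda>h. J *v h)) (at 0)" "det J \<noteq> 0"
    using cusp_family_derivative[of 0] by blast
  then have "regular_at C2 cusp_family (vector [0, 0])"
    unfolding vector2_zero
    by (intro regular_atI[of UNIV id C2 UNIV]) (use hol in \<open>auto simp: C2_def\<close>)
  moreover have "cusp_family (vector [0, 0]) = vector [1, 1]" by (simp add: cusp_family_def)
  ultimately show ?case
    using adapted_blowup[OF _ _ F _ _ V_first, of 0] by (metis ComplI open_Compl closed_singleton
      singletonD zero_neq_neg_numeral)
next
  case (V_step i V E p V' \<pi> T)
  then obtain F where F: "adapted (- {-4}) V E F" "\<And>s. regular_at V F (vector [0, s])"
    "E \<subseteq> range (\<lambda>s. F (vector [0, s]))" by blast
  then obtain s0 where "F (vector [0, s0]) = p" using V_step(2) by blast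
  then show ?case
    using adapted_blowup[OF _ _ F(1) F(2) _ V_step(3,4), of s0] by (metis ComplI open_Compl closed_singleton
      singletonD zero_neq_neg_numeral)
qed

theorem proposition4p7:
  fixes m :: nat and V :: "'a atlas" and E :: "'a set"
  assumes "m \<ge> 1"
    and "V_construction m V E"
  shows "dominable_by_C2 V"
proof -
  obtain F where F: "adapted (- {-4}) V E F" and reg: "regular_at V F (vector [0, 0])"
    using V_construction_adapted[OF assms(2)] by blast
  then have V: "complex_surface V" and hol: "\<And>z. z $ 1 \<noteq> -4 \<Longrightarrow> holomorphic_at V F z"
    by (auto simp: adapted_def)
  \<comment> \<open>The first coordinate is the exponential covering of the complement of -4,
    normalized to send 0 to 0, where \<open>F\<close> is regular; its derivative there is 4.\<close>
  define q :: "complex^2 \<Rightarrow> complex^2" where "q = (\<lambda>z. vector [4 * exp (z $ 1) - 4, z $ 2])"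
  have q1: "has_partials (\<lambda>z. 4 * exp (z $ 1) - 4) z (4 * exp (z $ 1)) 0" for z
    by (rule has_partials_compose[OF _ has_partials_nth(1), of "\<lambda>x. 4 * exp x - 4" "4 * exp (z $ 1)" z, simplified])
      (auto intro!: derivative_eq_intros)
  have q: "q holomorphic2_on UNIV"
    unfolding q_def by (rule holomorphic2_on_vector2) (use q1 has_partials_nth in blast)+
  have q': "(q has_derivative (\<lambda>h. (vector [vector [4, 0], vector [0, 1]] :: complex^2^2) *v h)) (at 0)"
    using has_derivative_vector2[OF q1 has_partials_nth(2), of 0] by (simp add: q_def)
  have "holomorphic_at V (F \<circ> q) z" for z
    by (rule holomorphic_at_precompose[OF hol q]) (auto simp: q_def)
  then have map: "holomorphic_map C2 V (F \<circ> q)" by (rule holomorphic_map_C2[OF V])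
  have "q 0 = vector [0, 0]" by (simp add: q_def)
  then have "regular_at V (F \<circ> q) 0"
    using regular_at_precompose[OF _ q _ q', of V F] reg by (simp add: det_vector2)
  then obtain U \<phi> J where "(U, \<phi>) \<in> V" "(F \<circ> q) 0 \<in> U"
    "(\<phi> \<circ> (F \<circ> q) has_derivative (\<lambda>h. (J :: complex^2^2) *v h)) (at 0)" "det J \<noteq> 0"
    by (rule regular_atE) blast
  then show ?thesis
    unfolding dominable_by_C2_def using V map by blast
qed

end
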